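(* Let $F\in \mathrm A^1_+(\mathbb C_+)$ be such that $z^{-\beta}F\in \mathrm A^1_+(\mathbb C_+)$ for some $\beta>0$, and denote $$\|F\|_{\mathrm A^1_+(\mathbb C_+)}=a\qquad\text{and}\qquad \|z^{-\beta}F\|_{\mathrm A^1_+(\mathbb C_+)}=b.$$ Then for any $f\in\mathcal S_\beta$ (generalized Stieltjes function of order $\beta$), $$\|Ff\|_{\mathrm A^1_+(\mathbb C_+)}\le 2^\beta\, a\, f\!\left(\left(\frac ab\right)^{1/\beta}c_\beta^{-1/\beta}\right).$$
   Context: $\mathbb C_+=\{z\in\mathbb C:\operatorname{Re}z>0\}$. $\mathrm A^1_+(\mathbb C_+)$ is the Banach algebra (under pointwise multiplication) of Laplace transforms $(\mathcal L\mu)(z)=\int_0^\infty e^{-sz}\mu(ds)$, $z\in\mathbb C_+$, of bounded Radon measures $\mu$ on $[0,\infty)$, normed by $\|\mathcal L\mu\|_{\mathrm A^1_+(\mathbb C_+)}=|\mu|([0,\infty))$ (total variation). $z^{-\beta}F$ denotes the function $z\mapsto z^{-\beta}F(z)$. $\mathcal S_\beta$ is the class of generalized Stieltjes functions of order $\beta$: functions $f:(0,\infty)\to[0,\infty)$ of the form $f(z)=\frac{a_0}{z^\beta}+b_0+\int_{(0,\infty)}\frac{\nu(ds)}{(z+s)^\beta}$ with $a_0,b_0\ge0$ and $\nu$ a positive Radon measure on $(0,\infty)$ with $\int_{(0,\infty)}\frac{\nu(ds)}{(1+s)^\beta}<\infty$; $f$ is identified with its analytic extension to $\mathbb C\setminus(-\infty,0]$.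 For $\beta>0$, $c_\beta:=\left\|\left(\frac{z}{z+1}\right)^\beta\right\|_{\mathrm A^1_+(\mathbb C_+)}$ (this function belongs to $\mathrm A^1_+(\mathbb C_+)$). *)

theory Defs
  imports "HOL-Probability.Probability" "HOL-Complex_Analysis.Complex_Analysis"
begin

section \<open>Complex measures\<close>

text \<open>
  A complex measure on the sigma-algebra of \<open>M\<close> is a countably additive complex-valued set
  function; the measure carried by \<open>M\<close> itself is irrelevant, only \<^term>\<open>space M\<close> and
  \<^term>\<open>sets M\<close> are used. Such a set function automatically has finite total variation.
\<close>

definition complex_measure :: "'a measure \<Rightarrow> ('a set \<Rightarrow> complex) \<Rightarrow> bool" where
  "complex_measure M \<mu> \<longleftrightarrow>
     (\<forall>A :: nat \<Rightarrow> 'a set. range A \<subseteq> sets M \<longrightarrow> disjoint_family A \<longrightarrow>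
        (\<lambda>n. \<mu> (A n)) sums \<mu> (\<Union>n. A n))"

definition variation :: "'a measure \<Rightarrow> ('a set \<Rightarrow> complex) \<Rightarrow> 'a set \<Rightarrow> ennreal" where
  "variation M \<mu> E =
     (SUP A \<in> {A :: nat \<Rightarrow> 'a set. range A \<subseteq> sets M \<and> disjoint_family A \<and> (\<Union>n. A n) = E}.
        \<Sum>n. ennreal (cmod (\<mu> (A n))))"

text \<open>
  The positive part in the Jordan decomposition of a real signed measure \<open>\<nu>\<close>,
  \<open>\<nu>\<^sup>+(E) = sup {\<nu>(A) | A \<subseteq> E}\<close>. Since \<^const>\<open>ennreal\<close> maps negative reals to 0 and
  \<open>\<nu>({}) = 0\<close>, truncation does not change the supremum. The negative part is the positive part
  of \<open>-\<nu>\<close>.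
\<close>

definition jordan_pos :: "'a measure \<Rightarrow> ('a set \<Rightarrow> real) \<Rightarrow> 'a measure" where
  "jordan_pos M \<nu> =
     measure_of (space M) (sets M) (\<lambda>E. SUP A \<in> {A \<in> sets M. A \<subseteq> E}. ennreal (\<nu> A))"

definition complex_measure_integral ::
    "'a measure \<Rightarrow> ('a set \<Rightarrow> complex) \<Rightarrow> ('a \<Rightarrow> complex) \<Rightarrow> complex" where
  "complex_measure_integral M \<mu> g =
     ((LINT x|jordan_pos M (\<lambda>A. Re (\<mu> A)). g x) - (LINT x|jordan_pos M (\<lambda>A. - Re (\<mu> A)). g x))
     + \<i> * ((LINT x|jordan_pos M (\<lambda>A. Im (\<mu> A)). g x) - (LINT x|jordan_pos M (\<lambda>A. - Im (\<mu> A)). g x))"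

section \<open>The algebra of Laplace transforms of bounded measures\<close>

text \<open>
  Every complex Borel measure on the half-line is a bounded Radon measure, regularity being
  automatic there.
\<close>

abbreviation half_line :: "real measure" where
  "half_line \<equiv> restrict_space borel {0..}"

definition laplace :: "(real set \<Rightarrow> complex) \<Rightarrow> complex \<Rightarrow> complex" where
  "laplace \<mu> z = complex_measure_integral half_line \<mu> (\<lambda>s. exp (- (complex_of_real s * z)))"

definition laplace_of :: "(complex \<Rightarrow> complex) \<Rightarrow> (real set \<Rightarrow> complex) \<Rightarrow> bool" where
  "laplace_of F \<mu> \<longleftrightarrow> complex_measure half_line \<mu> \<and> (\<forall>z. Re z > 0 \<longrightarrow> F z = laplace \<mu> z)"

text \<open>
  Elements are represented by total functions on \<^typ>\<open>complex\<close> of which only the values on the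
  open right half-plane matter. By injectivity of the Laplace transform, \<open>F\<close> determines its
  measure on Borel sets, so the norm is well defined.
\<close>

definition A1_plus :: "(complex \<Rightarrow> complex) set" where
  "A1_plus = {F. \<exists>\<mu>. laplace_of F \<mu>}"

definition A1_norm :: "(complex \<Rightarrow> complex) \<Rightarrow> real" where
  "A1_norm F = (THE r. \<exists>\<mu>. laplace_of F \<mu> \<and> r = enn2real (variation half_line \<mu> {0..}))"

definition c_const :: "real \<Rightarrow> real" where
  "c_const \<beta> = A1_norm (\<lambda>z. (z / (z + 1)) powr complex_of_real \<beta>)"

section \<open>Generalized Stieltjes functions\<close>

text \<open>Finiteness on compact sets implies regularity for the open half-line.\<close>

definition radon_measure_pos :: "real measure \<Rightarrow> bool" where
  "radon_measure_pos \<nu> \<longleftrightarrow> sets \<nu> = sets (restrict_space borel {0<..}) \<and>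
     (\<forall>K. compact K \<longrightarrow> K \<subseteq> {0<..} \<longrightarrow> emeasure \<nu> K < \<infinity>)"

text \<open>The values of \<open>f\<close> outside the open half-line are irrelevant.\<close>

definition gen_stieltjes :: "real \<Rightarrow> (real \<Rightarrow> real) set" where
  "gen_stieltjes \<beta> = {f. \<exists>a0 b0 \<nu>. a0 \<ge> 0 \<and> b0 \<ge> 0 \<and> radon_measure_pos \<nu> \<and>
     (\<integral>\<^sup>+ s. ennreal (1 / (1 + s) powr \<beta>) \<partial>\<nu>) < \<infinity> \<and>
     (\<forall>x>0. f x = a0 / x powr \<beta> + b0 + (LINT s|\<nu>. 1 / (x + s) powr \<beta>))}"

text \<open>\<open>g\<close> is the (unique) analytic extension of \<open>f\<close> to the plane slit along the nonpositive reals.\<close>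

definition analytic_extension :: "(real \<Rightarrow> real) \<Rightarrow> (complex \<Rightarrow> complex) \<Rightarrow> bool" where
  "analytic_extension f g \<longleftrightarrow> g holomorphic_on (- \<real>\<^sub>\<le>\<^sub>0) \<and>
     (\<forall>x>0. g (complex_of_real x) = complex_of_real (f x))"

end

theory Submission imports Defs begin

text \<open>
  For a single \<open>s > 0\<close> there are two estimates for \<open>F / (z + s) powr \<beta>\<close>: the Laplace representation of
  \<open>1 / (z + s) powr \<beta>\<close> by a positive kernel of mass \<open>1 / s powr \<beta>\<close> gives the bound \<open>a / s powr \<beta>\<close>, and
  the factorisation into \<open>F / z powr \<beta>\<close> and \<open>(z / (z + s)) powr \<beta>\<close>, a dilation of the function defining
  \<open>c = c_const \<beta>\<close>, gives the bound \<open>b c\<close>. The argument \<open>t\<close> of \<open>f\<close> in the claim is the point where the two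
  bounds agree, and their minimum is \<open>a / (max s t) powr \<beta> \<le> 2 powr \<beta> * a / (s + t) powr \<beta>\<close>. Integrating
  over \<open>s\<close> yields the theorem; \<open>c \<ge> 1\<close> takes care of the term \<open>a0 / z powr \<beta>\<close>.

  All elements of the algebra are handled as integrals \<open>\<integral> exp (- \<tau> z) * h \<partial>P\<close> over an arbitrary measure
  space with \<open>\<tau> \<ge> 0\<close>, so that convolutions and mixtures of measures become integrals over product spaces.
  Uniqueness of Fourier transforms makes the norm well defined, and analyticity reduces identities on the
  half-plane to positive reals.
\<close>

section \<open>Sums of measures\<close>

text \<open>Neither estimate can be integrated over all \<open>s\<close> on its own:
  \<open>a / s powr \<beta>\<close> may fail to be integrable near \<open>0\<close>, and
  \<open>b c\<close> does not decay while the Stieltjes measure may have infinite mass near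
  infinity. This forces the cut at \<open>s = t\<close>, with the kernel bound above
  \<open>t\<close> and the dilation bound below it.

  The norm is a total variation, but a Laplace integral over an arbitrary space only gives an upper
  bound for it: distinct points may share a value of \<open>\<tau>\<close>, and their weights may
  cancel. Exact values are needed only for the elements one starts from, and a density on the
  half-line itself attains them. Every construction therefore begins with exact densities and ends
  with an upper bound.

  The Stieltjes integral is never evaluated off the positive reals. The candidate for the product of
  \<open>F\<close> and \<open>g\<close> is assembled inside the algebra, and the two are compared
  only where the integral formula for \<open>f\<close> applies.\<close>

definition add_measure :: "'a measure \<Rightarrow> 'a measure \<Rightarrow> 'a measure" where
  "add_measure M N = measure_of (space M) (sets M) (\<lambda>A. emeasure M A + emeasure N A)"

lemma space_add_measure [simp]: "space (add_measure M N) = space M"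
  by (simp add: add_measure_def)

lemma sets_add_measure [simp, measurable_cong]: "sets (add_measure M N) = sets M"
  by (simp add: add_measure_def)

lemma emeasure_add_measure:
  assumes "sets N = sets M" "A \<in> sets M"
  shows "emeasure (add_measure M N) A = emeasure M A + emeasure N A"
proof (rule emeasure_measure_of[OF add_measure_def])
  show "countably_additive (sets (add_measure M N)) (\<lambda>A. emeasure M A + emeasure N A)"
    using assms by (auto simp: countably_additive_def suminf_add[symmetric] suminf_emeasure)
qed (use assms sets.sets_into_space in \<open>auto simp: positive_def\<close>)

lemma finite_measure_add_measure:
  assumes "finite_measure M" "finite_measure N" "sets N = sets M"
  shows "finite_measure (add_measure M N)"
proof
  have "space N = space M" using assms(3) by (rule sets_eq_imp_space_eq)
  then show "emeasure (add_measure M N) (space (add_measure M N)) \<noteq> \<infinity>"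
    using finite_measure.emeasure_finite[OF assms(1)] finite_measure.emeasure_finite[OF assms(2)] assms(3)
    by (simp add: emeasure_add_measure)
qed

lemma nn_integral_add_measure:
  assumes s: "sets N = sets M" and f: "f \<in> borel_measurable M"
  shows "nn_integral (add_measure M N) f = nn_integral M f + nn_integral N f"
  using f
proof (induction rule: borel_measurable_induct)
  case (cong f g)
  then show ?case using sets_eq_imp_space_eq[OF s] by (simp cong: nn_integral_cong_simp)
next
  case (set A)
  then show ?case using s by (simp add: emeasure_add_measure)
next
  case (mult u c)
  then show ?case using s by (simp add: nn_integral_cmult algebra_simps measurable_cong_sets[OF s refl])
next
  case (add u v)
  then show ?case using s by (simp add: nn_integral_add algebra_simps measurable_cong_sets[OF s refl])
next
  case (seq U)
  have U: "U i \<in> borel_measurable N" "U i \<in> borel_measurable (add_measure M N)" for i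
    using seq(1) s by (simp_all cong: measurable_cong_sets)
  have inc: "incseq (\<lambda>i. nn_integral M (U i))" "incseq (\<lambda>i. nn_integral N (U i))"
    using seq(3) by (auto simp: incseq_def le_fun_def intro!: nn_integral_mono)
  show ?case
    using seq U inc
    by (simp add: nn_integral_monotone_convergence_SUP ennreal_SUP_add image_comp)
qed

text \<open>Sums of measures serve two purposes: to dominate all four Jordan parts of a complex
  measure at once, and to move negative parts to the other side of an equation between signed
  measures. The real case subtracts integrals of positive and negative parts, which needs all of
  them finite; the complex case follows by components.\<close>

lemma has_bochner_integral_add_measure:
  fixes f :: "'a \<Rightarrow> complex"
  assumes s: "sets N = sets M" and f: "integrable M f" "integrable N f"
  shows "has_bochner_integral (add_measure M N) f (integral\<^sup>L M f + integral\<^sup>L N f)"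
proof -
  have real: "has_bochner_integral (add_measure M N) r (integral\<^sup>L M r + integral\<^sup>L N r)"
    if r: "integrable M r" "integrable N r" for r :: "'a \<Rightarrow> real"
  proof -
    have m[measurable]: "r \<in> borel_measurable M" using r(1) by simp
    have i: "integrable (add_measure M N) r"
      using r by (simp add: integrable_iff_bounded nn_integral_add_measure s)
    have fin: "(\<integral>\<^sup>+ x. ennreal (r x) \<partial>M) \<noteq> \<infinity>" "(\<integral>\<^sup>+ x. ennreal (- r x) \<partial>M) \<noteq> \<infinity>"
      "(\<integral>\<^sup>+ x. ennreal (r x) \<partial>N) \<noteq> \<infinity>" "(\<integral>\<^sup>+ x. ennreal (- r x) \<partial>N) \<noteq> \<infinity>"
      using r by (auto simp: real_integrable_def)
    have "integral\<^sup>L (add_measure M N) r = integral\<^sup>L M r + integral\<^sup>L N r"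
      unfolding real_lebesgue_integral_def[OF i] real_lebesgue_integral_def[OF r(1)]
        real_lebesgue_integral_def[OF r(2)]
      using fin by (simp add: nn_integral_add_measure s enn2real_plus top.not_eq_extremum)
    with i show ?thesis by (simp add: has_bochner_integral_iff)
  qed
  have m[measurable]: "f \<in> borel_measurable M" using f(1) by simp
  have i: "integrable (add_measure M N) f"
    using f by (simp add: integrable_iff_bounded nn_integral_add_measure s)
  have "integral\<^sup>L (add_measure M N) (\<lambda>x. Re (f x)) = integral\<^sup>L M (\<lambda>x. Re (f x)) + integral\<^sup>L N (\<lambda>x. Re (f x))"
       "integral\<^sup>L (add_measure M N) (\<lambda>x. Im (f x)) = integral\<^sup>L M (\<lambda>x. Im (f x)) + integral\<^sup>L N (\<lambda>x. Im (f x))"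
    using real[of "\<lambda>x. Re (f x)"] real[of "\<lambda>x. Im (f x)"] f by (auto simp: has_bochner_integral_iff)
  then have "integral\<^sup>L (add_measure M N) f = integral\<^sup>L M f + integral\<^sup>L N f"
    using f i by (simp add: complex_eq_iff)
  with i show ?thesis by (simp add: has_bochner_integral_iff)
qed

section \<open>Jordan decomposition\<close>

text \<open>The real and imaginary parts of a complex measure are of this kind, and the Jordan
  decomposition takes place at this level. Real values already force finite variation.\<close>

definition signed_measure :: "'a measure \<Rightarrow> ('a set \<Rightarrow> real) \<Rightarrow> bool" where
  "signed_measure M \<nu> \<longleftrightarrow>
     (\<forall>A :: nat \<Rightarrow> 'a set. range A \<subseteq> sets M \<longrightarrow> disjoint_family A \<longrightarrow>
        (\<lambda>n. \<nu> (A n)) sums \<nu> (\<Union>n. A n))"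

lemma signed_measureD:
  fixes A :: "nat \<Rightarrow> 'a set"
  assumes "signed_measure M \<nu>" "\<And>i. A i \<in> sets M" "disjoint_family A"
  shows "(\<lambda>n. \<nu> (A n)) sums \<nu> (\<Union>n. A n)"
  using assms unfolding signed_measure_def by blast

lemma signed_measure_uminus: "signed_measure M \<nu> \<Longrightarrow> signed_measure M (\<lambda>A. - \<nu> A)"
  unfolding signed_measure_def by (auto intro: sums_minus)

lemma signed_measure_empty: assumes "signed_measure M \<nu>" shows "\<nu> {} = 0"
proof -
  have "(\<lambda>n::nat. \<nu> {}) sums \<nu> {}"
    using signed_measureD[OF assms, of "\<lambda>_. {}"] by (simp add: disjoint_family_on_def)
  then show ?thesis using summable_const_iff sums_summable by blast
qed

lemma signed_measure_Un:
  assumes "signed_measure M \<nu>" "A \<in> sets M" "B \<in> sets M" "A \<inter> B = {}"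
  shows "\<nu> (A \<union> B) = \<nu> A + \<nu> B"
proof -
  have "(\<lambda>n. \<nu> (binaryset A B n)) sums \<nu> (A \<union> B)"
  proof -
    have "binaryset A B i \<in> sets M" for i using assms by (simp add: binaryset_def)
    moreover have "disjoint_family (binaryset A B)"
      using assms(4) by (auto simp: disjoint_family_on_def binaryset_def)
    ultimately show ?thesis
      using signed_measureD[OF assms(1), of "binaryset A B"] by (simp add: UN_binaryset_eq)
  qed
  moreover have "(\<lambda>n. \<nu> (binaryset A B n)) sums (\<nu> A + \<nu> B)"
    by (rule binaryset_sums) (rule signed_measure_empty[OF assms(1)])
  ultimately show ?thesis by (rule sums_unique2)
qed

lemma signed_measure_Diff:
  assumes "signed_measure M \<nu>" "A \<in> sets M" "E \<in> sets M" "A \<subseteq> E"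
  shows "\<nu> (E - A) = \<nu> E - \<nu> A"
  using signed_measure_Un[OF assms(1), of A "E - A"] assms by (simp add: Un_absorb1)

text \<open>This is the set function from which \<open>jordan_pos\<close> is built. It is named
  separately because \<open>measure_of\<close> takes on its values only once countable additivity is
  known.\<close>

definition positive_variation :: "'a measure \<Rightarrow> ('a set \<Rightarrow> real) \<Rightarrow> 'a set \<Rightarrow> ennreal" where
  "positive_variation M \<nu> E = (SUP A \<in> {A \<in> sets M. A \<subseteq> E}. ennreal (\<nu> A))"

lemma positive_variation_upper:
  "A \<in> sets M \<Longrightarrow> A \<subseteq> E \<Longrightarrow> ennreal (\<nu> A) \<le> positive_variation M \<nu> E"
  unfolding positive_variation_def by (rule SUP_upper) simp

lemma positive_variation_mono: "E \<subseteq> E' \<Longrightarrow> positive_variation M \<nu> E \<le> positive_variation M \<nu> E'"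
  unfolding positive_variation_def by (rule SUP_subset_mono) auto

lemma positive_variation_superadd:
  assumes \<nu>: "signed_measure M \<nu>" and "A \<inter> B = {}"
  shows "positive_variation M \<nu> A + positive_variation M \<nu> B \<le> positive_variation M \<nu> (A \<union> B)"
proof -
  have *: "ennreal (\<nu> S) + ennreal (\<nu> T) \<le> positive_variation M \<nu> (A \<union> B)"
    if "S \<in> sets M" "S \<subseteq> A" "T \<in> sets M" "T \<subseteq> B" for S T
  proof (cases "\<nu> S \<ge> 0 \<and> \<nu> T \<ge> 0")
    case True
    have "S \<inter> T = {}" using that assms by auto
    then have "ennreal (\<nu> S) + ennreal (\<nu> T) = ennreal (\<nu> (S \<union> T))"
      using True signed_measure_Un[OF \<nu>, of S T] that by simp
    also have "\<dots> \<le> positive_variation M \<nu> (A \<union> B)"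
      using that by (intro positive_variation_upper) auto
    finally show ?thesis .
  next
    \<comment> \<open>A negative value is truncated to \<open>0\<close>, so a single one of the two
      sets suffices as competitor.\<close>
    case False
    have "ennreal (\<nu> S) \<le> positive_variation M \<nu> (A \<union> B)" "ennreal (\<nu> T) \<le> positive_variation M \<nu> (A \<union> B)"
      using that by (auto intro!: positive_variation_upper)
    with False show ?thesis by (auto simp: ennreal_neg not_le)
  qed
  have ne: "{S \<in> sets M. S \<subseteq> E} \<noteq> {}" for E by auto
  show ?thesis
    unfolding positive_variation_def[of M \<nu> A] positive_variation_def[of M \<nu> B]
    by (subst ennreal_SUP_add_left[OF ne, symmetric], rule SUP_least,
        subst ennreal_SUP_add_right[OF ne], rule SUP_least) (use * in auto)
qed

lemma ennreal_add_le: "ennreal (x + y) \<le> ennreal x + ennreal y"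
  by (cases "x \<ge> 0"; cases "y \<ge> 0")
    (auto simp: ennreal_plus[symmetric] ennreal_neg not_le simp del: ennreal_plus intro!: ennreal_leI)

lemma ennreal_sum_le: "ennreal (\<Sum>i<n::nat. f i) \<le> (\<Sum>i<n. ennreal (f i))"
  by (induction n) (auto intro: order_trans[OF ennreal_add_le] add_right_mono)

text \<open>Superadditivity over finite unions and monotonicity give one inequality. For the other,
  a competitor \<open>A\<close> inside the union is cut into the pieces
  \<open>A \<inter> E i\<close>; truncation at \<open>0\<close> is subadditive, so the partial sums
  of their values stay below the sum of the positive variations.\<close>

lemma countably_additive_positive_variation:
  assumes \<nu>: "signed_measure M \<nu>"
  shows "countably_additive (sets M) (positive_variation M \<nu>)"
  unfolding countably_additive_def
proof (intro allI impI antisym)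
  fix E :: "nat \<Rightarrow> 'a set"
  assume E: "range E \<subseteq> sets M" "disjoint_family E"
  have "(\<Sum>i<n. positive_variation M \<nu> (E i)) \<le> positive_variation M \<nu> (\<Union>i<n. E i)" for n
  proof (induction n)
    case (Suc n)
    have "(\<Union>i<n. E i) \<inter> E n = {}"
    proof -
      have "E i \<inter> E n = {}" if "i < n" for i
        using disjoint_family_onD[OF E(2), of i n] that by simp
      then show ?thesis by auto
    qed
    then have "positive_variation M \<nu> (\<Union>i<n. E i) + positive_variation M \<nu> (E n)
        \<le> positive_variation M \<nu> ((\<Union>i<n. E i) \<union> E n)"
      by (rule positive_variation_superadd[OF \<nu>])
    also have "(\<Union>i<n. E i) \<union> E n = (\<Union>i<Suc n. E i)"
      by (auto simp: lessThan_Suc)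
    finally show ?case
      using Suc by (auto intro: order_trans[OF add_right_mono])
  qed simp
  also have "positive_variation M \<nu> (\<Union>i<n. E i) \<le> positive_variation M \<nu> (\<Union>i. E i)" for n
    by (rule positive_variation_mono) auto
  finally show "(\<Sum>i. positive_variation M \<nu> (E i)) \<le> positive_variation M \<nu> (\<Union>i. E i)"
    by (intro suminf_le_const) auto
  show "positive_variation M \<nu> (\<Union>i. E i) \<le> (\<Sum>i. positive_variation M \<nu> (E i))"
    unfolding positive_variation_def[of M \<nu> "\<Union>i. E i"]
  proof (intro SUP_least)
    fix A assume "A \<in> {A \<in> sets M. A \<subseteq> (\<Union>i. E i)}"
    then have A: "A \<in> sets M" "A = (\<Union>i. A \<inter> E i)" by auto
    have "(\<lambda>i. \<nu> (A \<inter> E i)) sums \<nu> (\<Union>i. A \<inter> E i)"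
    proof (rule signed_measureD[OF \<nu>])
      show "disjoint_family (\<lambda>i. A \<inter> E i)"
        using E(2) unfolding disjoint_family_on_def by blast
    qed (use A E in auto)
    then have "(\<lambda>n. \<Sum>i<n. \<nu> (A \<inter> E i)) \<longlonglongrightarrow> \<nu> A"
      using A(2) by (simp add: sums_def)
    then have "(\<lambda>n. ennreal (\<Sum>i<n. \<nu> (A \<inter> E i))) \<longlonglongrightarrow> ennreal (\<nu> A)"
      by (rule tendsto_ennrealI)
    moreover have "ennreal (\<Sum>i<n. \<nu> (A \<inter> E i)) \<le> (\<Sum>i. positive_variation M \<nu> (E i))" for n
    proof -
      have "ennreal (\<Sum>i<n. \<nu> (A \<inter> E i)) \<le> (\<Sum>i<n. ennreal (\<nu> (A \<inter> E i)))"
        by (rule ennreal_sum_le)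
      also have "\<dots> \<le> (\<Sum>i<n. positive_variation M \<nu> (E i))"
        using A E by (intro sum_mono positive_variation_upper) auto
      also have "\<dots> \<le> (\<Sum>i. positive_variation M \<nu> (E i))"
        by (intro sum_le_suminf) auto
      finally show ?thesis .
    qed
    ultimately show "ennreal (\<nu> A) \<le> (\<Sum>i. positive_variation M \<nu> (E i))"
      by (intro LIMSEQ_le_const2) auto
  qed
qed

lemma emeasure_jordan_pos:
  assumes "signed_measure M \<nu>" "E \<in> sets M"
  shows "emeasure (jordan_pos M \<nu>) E = positive_variation M \<nu> E"
proof -
  have eq: "jordan_pos M \<nu> = measure_of (space M) (sets M) (positive_variation M \<nu>)"
    by (simp add: jordan_pos_def positive_variation_def[abs_def])
  show ?thesis
  proof (rule emeasure_measure_of[OF eq])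
    show "positive (sets (jordan_pos M \<nu>)) (positive_variation M \<nu>)"
      by (simp add: positive_def positive_variation_def signed_measure_empty[OF assms(1)] Collect_conv_if)
    show "countably_additive (sets (jordan_pos M \<nu>)) (positive_variation M \<nu>)"
      using countably_additive_positive_variation[OF assms(1)] by (simp add: jordan_pos_def)
  qed (use assms(2) sets.sets_into_space in \<open>auto simp: jordan_pos_def\<close>)
qed

lemma sets_jordan_pos [simp, measurable_cong]: "sets (jordan_pos M \<nu>) = sets M"
  by (simp add: jordan_pos_def)

lemma space_jordan_pos [simp]: "space (jordan_pos M \<nu>) = space M"
  by (simp add: jordan_pos_def)

text \<open>
  A set of infinite positive variation splits into two pieces of measure at least 1 in absolute
  value, one of which again has infinite positive variation; iterating contradicts summability.
\<close>

lemma positive_variation_finite: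
  assumes \<nu>: "signed_measure M \<nu>" and E: "E \<in> sets M"
  shows "positive_variation M \<nu> E < \<infinity>"
proof (rule ccontr)
  assume inf: "\<not> ?thesis"
  define Q where "Q A \<longleftrightarrow> A \<in> sets M \<and> positive_variation M \<nu> A = \<infinity>" for A
  have step: "\<exists>B. Q B \<and> B \<subseteq> A \<and> \<bar>\<nu> (A - B)\<bar> \<ge> 1" if "Q A" for A
  proof -
    have A: "A \<in> sets M" "positive_variation M \<nu> A = \<infinity>" using that by (auto simp: Q_def)
    \<comment> \<open>The margin \<open>\<bar>\<nu> A\<bar> + 1\<close> makes both pieces large:
      \<open>\<nu> S > 1\<close> and \<open>\<nu> (A - S) = \<nu> A - \<nu> S < - 1\<close>. Hence
      either piece may be kept and the other one split off.\<close>
    have "ennreal (\<bar>\<nu> A\<bar> + 1) < positive_variation M \<nu> A" using A by simp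
    then obtain S where S: "S \<in> sets M" "S \<subseteq> A" "ennreal (\<bar>\<nu> A\<bar> + 1) < ennreal (\<nu> S)"
      unfolding positive_variation_def less_SUP_iff by auto
    have S1: "\<bar>\<nu> A\<bar> + 1 < \<nu> S" using S(3) by (subst (asm) ennreal_less_iff) auto
    have d: "\<nu> (A - S) = \<nu> A - \<nu> S" using signed_measure_Diff[OF \<nu> S(1) A(1) S(2)] .
    have AS: "A - (A - S) = S" using S by auto
    \<comment> \<open>Additivity of the positive variation is available before its finiteness, so at
      least one of the two pieces inherits the infinite value.\<close>
    have "emeasure (jordan_pos M \<nu>) A = emeasure (jordan_pos M \<nu>) S + emeasure (jordan_pos M \<nu>) (A - S)"
      using S A by (subst plus_emeasure) (auto simp: Un_absorb1)
    then have "positive_variation M \<nu> S = \<infinity> \<or> positive_variation M \<nu> (A - S) = \<infinity>"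
      using A S by (simp add: emeasure_jordan_pos[OF \<nu>]) (metis ennreal_add_eq_top)
    then have "Q S \<or> Q (A - S)" using A S by (auto simp: Q_def)
    then show ?thesis
    proof
      assume "Q S" then show ?thesis using S d S1 by (intro exI[of _ S]) auto
    next
      assume "Q (A - S)" then show ?thesis using AS S1 by (intro exI[of _ "A - S"]) auto
    qed
  qed
  have "Q E" using inf E by (auto simp: Q_def less_top[symmetric])
  then obtain f where f: "\<And>n::nat. Q (f n)" "\<And>n. f (Suc n) \<subseteq> f n \<and> \<bar>\<nu> (f n - f (Suc n))\<bar> \<ge> 1"
    using dependent_nat_choice[of "\<lambda>_. Q" "\<lambda>_ A B. B \<subseteq> A \<and> \<bar>\<nu> (A - B)\<bar> \<ge> 1"] step by metis
  have dec: "decseq f" using f(2) by (intro decseq_SucI) auto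
  have "disjoint_family (\<lambda>n. f n - f (Suc n))"
  proof -
    have "(f m - f (Suc m)) \<inter> (f n - f (Suc n)) = {}" if "m < n" for m n
      using decseqD[OF dec, of "Suc m" n] that by auto
    then show ?thesis
      unfolding disjoint_family_on_def by (metis Int_commute linorder_neqE_nat)
  qed
  then have "(\<lambda>n. \<nu> (f n - f (Suc n))) sums \<nu> (\<Union>n. f n - f (Suc n))"
    using f(1) by (intro signed_measureD[OF \<nu>]) (auto simp: Q_def)
  then have "(\<lambda>n. \<nu> (f n - f (Suc n))) \<longlonglongrightarrow> 0"
    using sums_summable summable_LIMSEQ_zero by blast
  then have "(\<lambda>n. \<bar>\<nu> (f n - f (Suc n))\<bar>) \<longlonglongrightarrow> 0" by (simp add: tendsto_rabs_zero)
  then have "1 \<le> (0::real)" using f(2) by (intro LIMSEQ_le_const) auto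
  then show False by simp
qed

lemma finite_measure_jordan_pos:
  assumes "signed_measure M \<nu>" shows "finite_measure (jordan_pos M \<nu>)"
  using positive_variation_finite[OF assms sets.top]
  by (intro finite_measureI) (simp add: emeasure_jordan_pos[OF assms])

text \<open>Since \<open>\<nu> A = \<nu> E - \<nu> (E - A)\<close>, each value on a subset of
  \<open>E\<close> is at most \<open>\<nu> E\<close> plus the negative variation of
  \<open>E\<close>. The supremum over \<open>A\<close> gives one inequality and the same argument
  for \<open>- \<nu>\<close> the other; no Hahn decomposition is involved.\<close>

lemma jordan_decomposition:
  assumes \<nu>: "signed_measure M \<nu>" and E: "E \<in> sets M"
  shows "\<nu> E = measure (jordan_pos M \<nu>) E - measure (jordan_pos M (\<lambda>A. - \<nu> A)) E"
proof -
  interpret P: finite_measure "jordan_pos M \<nu>" by (rule finite_measure_jordan_pos[OF \<nu>])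
  note \<nu>' = signed_measure_uminus[OF \<nu>]
  interpret N: finite_measure "jordan_pos M (\<lambda>A. - \<nu> A)" by (rule finite_measure_jordan_pos[OF \<nu>'])
  have up: "\<mu> A \<le> measure (jordan_pos M \<mu>) E"
    if "signed_measure M \<mu>" "A \<in> sets M" "A \<subseteq> E" for \<mu> A
  proof -
    interpret finite_measure "jordan_pos M \<mu>" by (rule finite_measure_jordan_pos[OF that(1)])
    have "ennreal (\<mu> A) \<le> ennreal (measure (jordan_pos M \<mu>) E)"
      using positive_variation_upper[OF that(2,3), of \<mu>] emeasure_jordan_pos[OF that(1) E]
      by (simp add: emeasure_eq_measure)
    then show ?thesis by (simp add: ennreal_le_iff)
  qed
  have least: "measure (jordan_pos M \<mu>) E \<le> c"
    if "signed_measure M \<mu>" "\<And>A. A \<in> sets M \<Longrightarrow> A \<subseteq> E \<Longrightarrow> \<mu> A \<le> c" for \<mu> c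
  proof -
    interpret finite_measure "jordan_pos M \<mu>" by (rule finite_measure_jordan_pos[OF that(1)])
    have "c \<ge> 0" using that(2)[of "{}"] signed_measure_empty[OF that(1)] by simp
    moreover have "positive_variation M \<mu> E \<le> ennreal c"
      unfolding positive_variation_def using that(2) by (intro SUP_least ennreal_leI) auto
    ultimately show ?thesis
      using emeasure_jordan_pos[OF that(1) E] by (simp add: emeasure_eq_measure flip: ennreal_le_iff)
  qed
  have "measure (jordan_pos M \<nu>) E \<le> \<nu> E + measure (jordan_pos M (\<lambda>A. - \<nu> A)) E"
  proof (rule least[OF \<nu>])
    fix A assume A: "A \<in> sets M" "A \<subseteq> E"
    show "\<nu> A \<le> \<nu> E + measure (jordan_pos M (\<lambda>A. - \<nu> A)) E"
      using up[OF \<nu>', of "E - A"] signed_measure_Diff[OF \<nu> A(1) E A(2)] A E by simp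
  qed
  moreover have "measure (jordan_pos M (\<lambda>A. - \<nu> A)) E \<le> measure (jordan_pos M \<nu>) E - \<nu> E"
  proof (rule least[OF \<nu>'])
    fix A assume A: "A \<in> sets M" "A \<subseteq> E"
    show "- \<nu> A \<le> measure (jordan_pos M \<nu>) E - \<nu> E"
      using up[OF \<nu>, of "E - A"] signed_measure_Diff[OF \<nu> A(1) E A(2)] A E by simp
  qed
  ultimately show ?thesis by simp
qed

section \<open>Densities of complex measures\<close>

text \<open>Domination gives absolute continuity, hence a Radon-Nikodym derivative. A version that
  is real and nonnegative everywhere is chosen so that it can enter Bochner integrals; its integral
  is the finite mass of \<open>J\<close>.\<close>

lemma dominated_density:
  assumes P: "finite_measure P" and s: "sets J = sets P"
    and le: "\<And>A. A \<in> sets P \<Longrightarrow> emeasure J A \<le> emeasure P A"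
  obtains f :: "'a \<Rightarrow> real"
  where "integrable P f" "\<And>x. 0 \<le> f x" "J = density P (\<lambda>x. ennreal (f x))"
proof -
  interpret P: finite_measure P by fact
  have J: "finite_measure J"
    using le[of "space P"] P.emeasure_finite[of "space P"] sets_eq_imp_space_eq[OF s]
    by (intro finite_measureI) (auto simp: top_unique)
  have ac: "absolutely_continuous P J"
    unfolding absolutely_continuous_def
  proof
    fix A assume "A \<in> null_sets P"
    then have "A \<in> sets P" "emeasure P A = 0" by auto
    with le[of A] s show "A \<in> null_sets J" by (auto intro: null_setsI)
  qed
  obtain D where D: "D \<in> borel_measurable P" "AE x in P. RN_deriv P J x = ennreal (D x)" "\<And>x. 0 \<le> D x"
    using P.real_RN_deriv[OF J ac s] by metis
  have eq: "J = density P (\<lambda>x. ennreal (D x))"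
    using P.density_RN_deriv[OF ac s] D density_cong[of "RN_deriv P J" P "\<lambda>x. ennreal (D x)"] by simp
  have "(\<integral>\<^sup>+ x. ennreal (D x) \<partial>P) = emeasure J (space P)"
    using D(1) by (subst eq, subst emeasure_density) (auto intro!: nn_integral_cong)
  also have "\<dots> < \<infinity>" 
    using finite_measure.emeasure_finite[OF J] by (simp add: less_top[symmetric])
  finally have "integrable P D"
    using D by (simp add: integrable_iff_bounded)
  then show thesis using that D eq by blast
qed

lemma complex_measure_Re: "complex_measure M \<mu> \<Longrightarrow> signed_measure M (\<lambda>A. Re (\<mu> A))"
  and complex_measure_Im: "complex_measure M \<mu> \<Longrightarrow> signed_measure M (\<lambda>A. Im (\<mu> A))"
  unfolding complex_measure_def signed_measure_def by (auto intro: sums_Re sums_Im)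

text \<open>Each of the four Jordan parts is dominated by their sum \<open>P\<close>, so their
  densities combine into a single complex \<open>h\<close>. The four terms of
  \<open>complex_measure_integral\<close> thereby become one Bochner integral, and later arguments
  work with \<open>h\<close> instead of the Jordan parts.\<close>

lemma complex_measure_density:
  assumes \<mu>: "complex_measure M \<mu>"
  obtains P and h :: "'a \<Rightarrow> complex"
  where "finite_measure P" "sets P = sets M" "integrable P h"
    "\<And>A. A \<in> sets M \<Longrightarrow> \<mu> A = (LINT x:A|P. h x)"
    "\<And>g. g \<in> borel_measurable M \<Longrightarrow> bounded (g ` space M) \<Longrightarrow>
       complex_measure_integral M \<mu> g = (LINT x|P. g x * h x)"
proof -
  let ?J1 = "jordan_pos M (\<lambda>A. Re (\<mu> A))" and ?J2 = "jordan_pos M (\<lambda>A. - Re (\<mu> A))"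
  let ?J3 = "jordan_pos M (\<lambda>A. Im (\<mu> A))" and ?J4 = "jordan_pos M (\<lambda>A. - Im (\<mu> A))"
  note R = complex_measure_Re[OF \<mu>] and I = complex_measure_Im[OF \<mu>]
  note R' = signed_measure_uminus[OF R] and I' = signed_measure_uminus[OF I]
  note fin = finite_measure_jordan_pos[OF R] finite_measure_jordan_pos[OF I]
    finite_measure_jordan_pos[OF R'] finite_measure_jordan_pos[OF I']
  define P where "P = add_measure (add_measure ?J1 ?J2) (add_measure ?J3 ?J4)"
  have P: "finite_measure P"
    unfolding P_def using fin by (intro finite_measure_add_measure) auto
  have sP[measurable_cong, simp]: "sets P = sets M" by (simp add: P_def)
  have spP[simp]: "space P = space M" by (rule sets_eq_imp_space_eq) simp
  have eP: "emeasure P A = emeasure ?J1 A + emeasure ?J2 A + (emeasure ?J3 A + emeasure ?J4 A)"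
    if "A \<in> sets M" for A
    using that by (simp add: P_def emeasure_add_measure)
  have le: "emeasure ?J1 A \<le> emeasure P A" "emeasure ?J2 A \<le> emeasure P A"
    "emeasure ?J3 A \<le> emeasure P A" "emeasure ?J4 A \<le> emeasure P A" if "A \<in> sets P" for A
    using that unfolding sP by (simp_all add: eP add_increasing add_increasing2)
  obtain f1 where f1: "integrable P f1" "\<And>x. 0 \<le> f1 x" "?J1 = density P (\<lambda>x. ennreal (f1 x))"
    by (rule dominated_density[OF P _ le(1)]) auto
  obtain f2 where f2: "integrable P f2" "\<And>x. 0 \<le> f2 x" "?J2 = density P (\<lambda>x. ennreal (f2 x))"
    by (rule dominated_density[OF P _ le(2)]) auto
  obtain f3 where f3: "integrable P f3" "\<And>x. 0 \<le> f3 x" "?J3 = density P (\<lambda>x. ennreal (f3 x))"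
    by (rule dominated_density[OF P _ le(3)]) auto
  obtain f4 where f4: "integrable P f4" "\<And>x. 0 \<le> f4 x" "?J4 = density P (\<lambda>x. ennreal (f4 x))"
    by (rule dominated_density[OF P _ le(4)]) auto
  define h where "h x = complex_of_real (f1 x - f2 x) + \<i> * complex_of_real (f3 x - f4 x)" for x
  have h: "integrable P h" unfolding h_def using f1 f2 f3 f4 by auto
  have cmi: "complex_measure_integral M \<mu> g = (LINT x|P. g x * h x)"
    if g: "g \<in> borel_measurable M" "bounded (g ` space M)" for g
  proof -
    obtain B where B: "\<And>x. x \<in> space M \<Longrightarrow> norm (g x) \<le> B" 
      using g(2) by (auto simp: bounded_iff)
    have gP[measurable]: "g \<in> borel_measurable P" using g(1) by simp
    have int: "integrable P (\<lambda>x. f x *\<^sub>R g x)" if "integrable P f" "\<And>x. 0 \<le> f x" for f :: "'a \<Rightarrow> real"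
    proof (rule Bochner_Integration.integrable_bound)
      show "integrable P (\<lambda>x. B * f x)" using that by simp
      show "AE x in P. norm (f x *\<^sub>R g x) \<le> norm (B * f x)"
      proof (rule AE_I2)
        fix x assume "x \<in> space P"
        then have "norm (g x) \<le> \<bar>B\<bar>" using B[of x] by simp
        then show "norm (f x *\<^sub>R g x) \<le> norm (B * f x)"
          using that(2)[of x] mult_right_mono[of "norm (g x)" "\<bar>B\<bar>" "f x"] by (simp add: abs_mult mult.commute)
      qed
    qed (use that in measurable)
    have dens: "integral\<^sup>L (density P (\<lambda>x. ennreal (f x))) g = (LINT x|P. f x *\<^sub>R g x)"
      if "integrable P f" "\<And>x. 0 \<le> f x" for f :: "'a \<Rightarrow> real"
      using that by (intro integral_density) auto
    have "(LINT x|P. g x * h x) = (LINT x|P. (f1 x *\<^sub>R g x - f2 x *\<^sub>R g x) + \<i> * (f3 x *\<^sub>R g x - f4 x *\<^sub>R g x))"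
      by (intro Bochner_Integration.integral_cong) (auto simp: h_def scaleR_conv_of_real algebra_simps)
    also have "\<dots> = ((LINT x|P. f1 x *\<^sub>R g x) - (LINT x|P. f2 x *\<^sub>R g x)) +
        \<i> * ((LINT x|P. f3 x *\<^sub>R g x) - (LINT x|P. f4 x *\<^sub>R g x))"
      using int[OF f1(1,2)] int[OF f2(1,2)] int[OF f3(1,2)] int[OF f4(1,2)] by simp
    also have "\<dots> = complex_measure_integral M \<mu> g"
      unfolding complex_measure_integral_def f1(3) f2(3) f3(3) f4(3)
      using dens[OF f1(1,2)] dens[OF f2(1,2)] dens[OF f3(1,2)] dens[OF f4(1,2)] by simp
    finally show ?thesis by simp
  qed
  have "\<mu> A = (LINT x:A|P. h x)" if A: "A \<in> sets M" for A
  proof -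
    have ind: "integral\<^sup>L J (indicator A :: _ \<Rightarrow> complex) = complex_of_real (measure J A)"
      if "sets J = sets M" for J
    proof -
      have "A \<inter> space J = A" using that A sets.sets_into_space by blast
      then have "integral\<^sup>L J (\<lambda>x. complex_of_real (indicator A x)) = complex_of_real (measure J A)"
        by simp
      then show ?thesis by (simp add: of_real_indicator)
    qed
    have b: "bounded ((indicator A :: _ \<Rightarrow> complex) ` space M)"
      by (rule boundedI[of _ 1]) (auto simp: indicator_def)
    \<comment> \<open>On sets the formula is the integral formula for an indicator; the Jordan
      decomposition turns the four integrals back into \<open>\<mu> A\<close>.\<close>
    have "\<mu> A = complex_measure_integral M \<mu> (indicator A)"
      unfolding complex_measure_integral_def
      using jordan_decomposition[OF R A] jordan_decomposition[OF I A]
      by (simp add: ind complex_eq_iff)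
    also have "\<dots> = (LINT x|P. indicator A x * h x)"
      using A b by (intro cmi) auto
    also have "\<dots> = (LINT x:A|P. h x)"
      unfolding set_lebesgue_integral_def
      by (intro Bochner_Integration.integral_cong) (auto simp: indicator_def)
    finally show ?thesis .
  qed
  with P sP h cmi show thesis using that by blast
qed

text \<open>The density \<open>norm (h x)\<close> gives a finite measure \<open>N\<close>, and the
  modulus of \<open>\<mu> A\<close> is at most the \<open>N\<close>-mass of the preimage of
  \<open>A\<close>. Countable additivity of \<open>N\<close> then yields both the convergence of the
  series and the bound on the variation.\<close>

lemma pushforward_complex_measure:
  fixes h :: "'a \<Rightarrow> complex"
  assumes \<tau>[measurable]: "\<tau> \<in> measurable P M" and h: "integrable P h"
    and \<mu>: "\<And>A. A \<in> sets M \<Longrightarrow> \<mu> A = (LINT x:(\<tau> -` A \<inter> space P)|P. h x)"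
  shows "complex_measure M \<mu>" and "variation M \<mu> E \<le> ennreal (LINT x|P. norm (h x))"
proof -
  define N where "N = density P (\<lambda>x. ennreal (norm (h x)))"
  have eN: "emeasure N B = (\<integral>\<^sup>+x. ennreal (indicator B x * norm (h x)) \<partial>P)" if "B \<in> sets P" for B
    using that h by (auto simp: N_def emeasure_density intro!: nn_integral_cong simp: indicator_def)
  have "emeasure N (space P) = (\<integral>\<^sup>+x. ennreal (norm (h x)) \<partial>P)"
    by (subst eN) (auto intro!: nn_integral_cong)
  also have "\<dots> = ennreal (LINT x|P. norm (h x))" using h by (intro nn_integral_eq_integral) auto
  finally have tot: "emeasure N (space P) = ennreal (LINT x|P. norm (h x))" .
  interpret N: finite_measure N
    using tot by (intro finite_measureI) (simp add: N_def)
  have hB: "set_integrable P B h" if "B \<in> sets P" for B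
    unfolding set_integrable_def using that h by (intro integrable_mult_indicator)
  have le: "norm (LINT x:B|P. h x) \<le> measure N B" if B: "B \<in> sets P" for B
  proof -
    have "norm (LINT x:B|P. h x) \<le> (LINT x|P. indicator B x * norm (h x))"
      unfolding set_lebesgue_integral_def
      using integral_norm_bound[of P "\<lambda>x. indicator B x *\<^sub>R h x"] by simp
    moreover have "integrable P (\<lambda>x. indicator B x * norm (h x))"
      using integrable_mult_indicator[OF B integrable_norm[OF h]] by simp
    then have "emeasure N B = ennreal (LINT x|P. indicator B x * norm (h x))"
      using B by (subst eN, simp, intro nn_integral_eq_integral) auto
    then have "measure N B = (LINT x|P. indicator B x * norm (h x))"
      by (simp add: measure_def)
    ultimately show ?thesis by simp
  qed
  have sums: "(\<lambda>n. \<mu> (A n)) sums \<mu> (\<Union>n. A n) \<and>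
      (\<Sum>n. ennreal (cmod (\<mu> (A n)))) \<le> ennreal (LINT x|P. norm (h x))"
    if A: "range A \<subseteq> sets M" "disjoint_family A" for A :: "nat \<Rightarrow> _"
  proof -
    define B where "B n = \<tau> -` A n \<inter> space P" for n
    have B: "B n \<in> sets P" for n using A(1) by (auto simp: B_def)
    have dB: "disjoint_family B" using A(2) unfolding B_def disjoint_family_on_def by blast
    have UB: "\<tau> -` (\<Union>n. A n) \<inter> space P = (\<Union>n. B n)" by (auto simp: B_def)
    have mA: "\<mu> (A n) = (LINT x:B n|P. h x)" for n using A(1) \<mu> by (auto simp: B_def)
    have mN: "(\<lambda>n. measure N (B n)) sums measure N (\<Union>n. B n)"
      using B dB by (intro N.finite_measure_UNION) (auto simp: N_def)
    have summ: "summable (\<lambda>n. \<mu> (A n))"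
      by (rule summable_comparison_test'[OF sums_summable[OF mN], of 0]) (simp add: mA le B)
    have "\<mu> (\<Union>n. A n) = (LINT x:(\<Union>n. B n)|P. h x)" using \<mu>[of "\<Union>n. A n"] A(1) UB by auto
    also have "\<dots> = (\<Sum>n. LINT x:B n|P. h x)"
      using B dB hB[of "\<Union>n. B n"] 
      by (intro lebesgue_integral_countable_add) (auto simp: disjoint_family_on_def)
    finally have "(\<lambda>n. \<mu> (A n)) sums \<mu> (\<Union>n. A n)" using summ by (simp add: sums_iff mA)
    moreover have "(\<Sum>n. ennreal (cmod (\<mu> (A n)))) \<le> (\<Sum>n. emeasure N (B n))"
      using le B by (intro suminf_le) (auto simp: mA N.emeasure_eq_measure ennreal_leI)
    moreover have "(\<Sum>n. emeasure N (B n)) = emeasure N (\<Union>n. B n)"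
      using B dB by (intro suminf_emeasure) (auto simp: N_def)
    moreover have "emeasure N (\<Union>n. B n) \<le> emeasure N (space N)" by (rule emeasure_space)
    ultimately show ?thesis using tot by (simp add: N_def)
  qed
  then show "complex_measure M \<mu>" by (auto simp: complex_measure_def)
  show "variation M \<mu> E \<le> ennreal (LINT x|P. norm (h x))"
    unfolding variation_def using sums by (intro SUP_least) auto
qed

text \<open>
  For the lower bound the space is cut into countably many pieces on each of which the argument of
  the density is almost constant.
\<close>

lemma variation_density:
  fixes h :: "'a \<Rightarrow> complex"
  assumes s: "sets P = sets M" and h: "integrable P h"
    and \<mu>: "\<And>A. A \<in> sets M \<Longrightarrow> \<mu> A = (LINT x:A|P. h x)"
  shows "variation M \<mu> (space M) = ennreal (LINT x|P. norm (h x))"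
proof (rule antisym)
  note sp[simp] = sets_eq_imp_space_eq[OF s]
  have id: "(\<lambda>x. x) \<in> measurable P M" using s by (simp cong: measurable_cong_sets)
  show "variation M \<mu> (space M) \<le> ennreal (LINT x|P. norm (h x))"
  proof (rule pushforward_complex_measure(2)[OF id h])
    fix A assume "A \<in> sets M"
    moreover from this have "(\<lambda>x. x) -` A \<inter> space P = A" using sets.sets_into_space by fastforce
    ultimately show "\<mu> A = (LINT x:(\<lambda>x. x) -` A \<inter> space P|P. h x)" using \<mu> by simp
  qed
  have [measurable]: "h \<in> borel_measurable P" using h by simp
  have key: "ennreal (z * (LINT x|P. norm (h x))) \<le> variation M \<mu> (space M)" if z: "0 < z" "z < 1" for z
  proof -
    obtain D :: "complex set" where D: "countable D" "\<And>X. open X \<Longrightarrow> X \<noteq> {} \<Longrightarrow> \<exists>d\<in>D. d \<in> X"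
      by (erule countable_dense_setE)
    have Dne: "D \<noteq> {}" using D(2)[of UNIV] by auto
    define d where "d = from_nat_into D"
    have d: "\<exists>n. d n \<in> X" if "open X" "X \<noteq> {}" for X
      using D(2)[OF that] D(1) unfolding d_def by (metis from_nat_into_surj)
    \<comment> \<open>On \<open>A n\<close> the values of \<open>h\<close> point nearly in the
      direction of \<open>d n\<close>: the real part of \<open>cnj (d n) * h x\<close> is at least
      \<open>z\<close> times its modulus. Density of the sequence \<open>d\<close> makes these sets
      cover the space.\<close>
    define A where "A n = {x \<in> space P. d n \<noteq> 0 \<and> z * (norm (d n) * norm (h x)) \<le> Re (cnj (d n) * h x)}" for n
    have A[measurable]: "A n \<in> sets P" for n unfolding A_def by measurable
    have cover: "(\<Union>n. A n) = space P"
    proof (intro equalityI subsetI)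
      fix x assume x: "x \<in> space P"
      show "x \<in> (\<Union>n. A n)"
      proof (cases "h x = 0")
        case True
        have "open (- {0::complex})" "- {0::complex} \<noteq> {}" by auto
        then obtain n where "d n \<noteq> 0" using d[of "- {0}"] by auto
        then show ?thesis using x True by (auto simp: A_def)
      next
        case False
        define U where "U = {w. w \<noteq> 0} \<inter> {w. z * (norm w * norm (h x)) < Re (cnj w * h x)}"
        have "open U" unfolding U_def
          by (intro open_Int open_Collect_neq open_Collect_less continuous_intros)
        moreover have "z * (norm (h x) * norm (h x)) < 1 * (norm (h x) * norm (h x))"
          using False z by (intro mult_strict_right_mono) auto
        then have "h x \<in> U" using False
          by (simp add: U_def cmod_def power2_eq_square)
        ultimately obtain n where "d n \<in> U" using d by blast
        then show ?thesis using x by (auto simp: U_def A_def)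
      qed
    qed (auto simp: A_def)
    define B where "B = disjointed A"
    have B: "B n \<in> sets P" for n unfolding B_def using A
      by (metis image_subset_iff sets.range_disjointed_sets UNIV_I)
    have BA: "B n \<subseteq> A n" for n by (simp add: B_def disjointed_subset)
    have dB: "disjoint_family B" by (simp add: B_def disjoint_family_disjointed)
    have UB: "(\<Union>n. B n) = space P" using cover by (simp add: B_def UN_disjointed_eq)
    have hB: "integrable P (\<lambda>x. indicator (B n) x *\<^sub>R h x)" for n
      by (rule integrable_mult_indicator[OF B h])
    have nB: "integrable P (\<lambda>x. indicator (B n) x *\<^sub>R norm (h x))" for n
      by (rule integrable_mult_indicator[OF B integrable_norm[OF h]])
    have em: "emeasure (density P (\<lambda>x. ennreal (norm (h x)))) C = (\<integral>\<^sup>+x. ennreal (norm (h x)) * indicator C x \<partial>P)"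
      if "C \<in> sets P" for C
    proof (rule emeasure_density[OF _ that])
      show "(\<lambda>x. ennreal (norm (h x))) \<in> borel_measurable P"
        by (rule measurable_compose[OF measurable_compose[OF borel_measurable_integrable[OF h] borel_measurable_norm] measurable_ennreal])
    qed
    have low: "z * (LINT x:B n|P. norm (h x)) \<le> cmod (\<mu> (B n))" for n
    proof (cases "d n = 0")
      case True
      then have "B n = {}" using BA[of n] by (auto simp: A_def)
      then show ?thesis by (simp add: set_lebesgue_integral_def)
    next
      case False
      \<comment> \<open>Multiplication by \<open>cnj (d n)\<close> turns the values on
        \<open>B n\<close> towards the positive axis, so that the real part of the integral loses at
        most the factor \<open>z\<close> against the integral of the modulus.\<close>
      have "norm (d n) * (z * (LINT x:B n|P. norm (h x))) = (LINT x|P. norm (d n) * z * (indicator (B n) x *\<^sub>R norm (h x)))"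
        unfolding set_lebesgue_integral_def by (subst integral_mult_right_zero) simp
      also have "\<dots> \<le> (LINT x|P. Re (cnj (d n) * (indicator (B n) x *\<^sub>R h x)))"
      proof (rule integral_mono)
        show "norm (d n) * z * (indicator (B n) x *\<^sub>R norm (h x)) \<le> Re (cnj (d n) * (indicator (B n) x *\<^sub>R h x))"
          for x
          using BA[of n] by (auto simp: A_def indicator_def mult_ac)
      qed (intro integrable_mult_right integrable_Re hB nB)+
      also have "\<dots> = Re (cnj (d n) * (LINT x:B n|P. h x))"
        unfolding set_lebesgue_integral_def integral_mult_right_zero[symmetric]
        by (rule integral_Re[OF integrable_mult_right[OF hB]])
      also have "\<dots> \<le> norm (cnj (d n) * (LINT x:B n|P. h x))" by (rule complex_Re_le_cmod)
      also have "\<dots> = norm (d n) * norm (\<mu> (B n))" using \<mu> B s by (simp add: norm_mult)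
      finally show ?thesis using False by simp
    qed
    have "ennreal (z * (LINT x|P. norm (h x))) = ennreal z * (\<integral>\<^sup>+x. norm (h x) \<partial>P)"
    proof -
      have "(\<integral>\<^sup>+x. norm (h x) \<partial>P) = ennreal (LINT x|P. norm (h x))"
        by (rule nn_integral_eq_integral) (use h in auto)
      then show ?thesis using z by (simp only: ennreal_mult')
    qed
    also have "(\<integral>\<^sup>+x. norm (h x) \<partial>P) = (\<integral>\<^sup>+x. ennreal (norm (h x)) * indicator (space P) x \<partial>P)"
      by (rule nn_integral_cong) simp
    also have "\<dots> = emeasure (density P (\<lambda>x. norm (h x))) (\<Union>n. B n)"
      unfolding UB by (rule em[OF sets.top, symmetric])
    also have "\<dots> = (\<Sum>n. emeasure (density P (\<lambda>x. norm (h x))) (B n))"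
      by (rule suminf_emeasure[symmetric]) (use B dB in auto)
    also have "ennreal z * \<dots> = (\<Sum>n. ennreal z * emeasure (density P (\<lambda>x. norm (h x))) (B n))"
      by (rule ennreal_suminf_cmult[symmetric])
    also have "\<dots> \<le> (\<Sum>n. ennreal (cmod (\<mu> (B n))))"
    proof (intro suminf_le)
      fix n
      have "emeasure (density P (\<lambda>x. norm (h x))) (B n) = (\<integral>\<^sup>+x. ennreal (indicator (B n) x *\<^sub>R norm (h x)) \<partial>P)"
        unfolding em[OF B] by (intro nn_integral_cong) (simp split: split_indicator)
      also have "\<dots> = ennreal (LINT x:B n|P. norm (h x))"
        unfolding set_lebesgue_integral_def using nB by (intro nn_integral_eq_integral) auto
      finally show "ennreal z * emeasure (density P (\<lambda>x. norm (h x))) (B n) \<le> ennreal (cmod (\<mu> (B n)))"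
        using low[of n] z by (simp add: ennreal_mult'[symmetric] ennreal_leI)
    qed auto
    also have "\<dots> \<le> variation M \<mu> (space M)"
      unfolding variation_def using B dB UB s by (intro SUP_upper2[where i = B]) auto
    finally show ?thesis .
  qed
  show "ennreal (LINT x|P. norm (h x)) \<le> variation M \<mu> (space M)"
  proof (cases "variation M \<mu> (space M)")
    case (real r)
    have "(LINT x|P. norm (h x)) \<le> r"
    proof (rule field_le_mult_one_interval)
      fix z :: real assume "0 < z" "z < 1"
      then have "ennreal (z * (LINT x|P. norm (h x))) \<le> ennreal r" using key real(2) by metis
      then show "z * (LINT x|P. norm (h x)) \<le> r" by (rule ennreal_le_iff[THEN iffD1, OF real(1)])
    qed
    then show ?thesis unfolding real(2) by (rule ennreal_leI)
  qed simp
qed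

text \<open>A change of variables for complex measures: equality on sets passes to simple functions
  by linearity and to bounded \<open>g\<close> by dominated convergence. It serves to replace a
  Laplace integral over an arbitrary space by one over the half-line.\<close>

lemma set_integrals_determine:
  fixes h1 :: "'a \<Rightarrow> complex" and h2 :: "'b \<Rightarrow> complex" and g :: "'c \<Rightarrow> complex"
  assumes \<tau>1[measurable]: "\<tau>1 \<in> measurable P1 M" and \<tau>2[measurable]: "\<tau>2 \<in> measurable P2 M"
    and h1: "integrable P1 h1" and h2: "integrable P2 h2"
    and eq: "\<And>A. A \<in> sets M \<Longrightarrow>
      (LINT x:(\<tau>1 -` A \<inter> space P1)|P1. h1 x) = (LINT x:(\<tau>2 -` A \<inter> space P2)|P2. h2 x)"
    and g: "g \<in> borel_measurable M" "bounded (g ` space M)"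
  shows "(LINT x|P1. g (\<tau>1 x) * h1 x) = (LINT x|P2. g (\<tau>2 x) * h2 x)"
proof -
  obtain B where B: "\<And>x. x \<in> space M \<Longrightarrow> norm (g x) \<le> B"
    using g(2) by (auto simp: bounded_iff)
  obtain S where S: "\<And>i. simple_function M (S i)" "\<And>x. x \<in> space M \<Longrightarrow> (\<lambda>i. S i x) \<longlonglongrightarrow> g x"
    "\<And>i x. x \<in> space M \<Longrightarrow> norm (S i x) \<le> 2 * norm (g x)"
    using borel_measurable_implies_sequence_metric[OF g(1), of 0] by (auto simp: norm_conv_dist[symmetric] dist_0_norm) metis
  have Sm[measurable]: "S i \<in> borel_measurable M" for i using S(1) by (rule borel_measurable_simple_function)
  note g(1)[measurable]
  have lim: "(\<lambda>i. LINT x|P. S i (\<tau> x) * h x) \<longlonglongrightarrow> (LINT x|P. g (\<tau> x) * h x)"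
    if [measurable]: "\<tau> \<in> measurable P M" and h: "integrable P h" for P :: "'d measure" and \<tau> h
  proof (rule integral_dominated_convergence)
    have [measurable]: "h \<in> borel_measurable P" using h by simp
    show "(\<lambda>x. g (\<tau> x) * h x) \<in> borel_measurable P" "\<And>i. (\<lambda>x. S i (\<tau> x) * h x) \<in> borel_measurable P"
      by measurable
    show "integrable P (\<lambda>x. 2 * B * norm (h x))" using h by simp
    show "AE x in P. (\<lambda>i. S i (\<tau> x) * h x) \<longlonglongrightarrow> g (\<tau> x) * h x"
      using S(2) measurable_space[OF that(1)] by (intro AE_I2 tendsto_mult tendsto_const) auto
    show "AE x in P. norm (S i (\<tau> x) * h x) \<le> 2 * B * norm (h x)" for i
    proof (rule AE_I2)
      fix x assume "x \<in> space P"
      then have "\<tau> x \<in> space M" by (rule measurable_space[OF that(1)])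
      then have "norm (S i (\<tau> x)) \<le> 2 * B" using S(3)[of "\<tau> x" i] B[of "\<tau> x"] by linarith
      then show "norm (S i (\<tau> x) * h x) \<le> 2 * B * norm (h x)"
        by (simp add: norm_mult mult_right_mono)
    qed
  qed
  have simp: "(LINT x|P. S i (\<tau> x) * h x) =
      (\<Sum>y \<in> S i ` space M. y * (LINT x:(\<tau> -` (S i -` {y} \<inter> space M) \<inter> space P)|P. h x))"
    if t[measurable]: "\<tau> \<in> measurable P M" and h: "integrable P h" for P :: "'d measure" and \<tau> h i
  proof -
    let ?A = "\<lambda>y. S i -` {y} \<inter> space M"
    have A: "?A y \<in> sets M" for y using simple_functionD(2)[OF S(1)[of i], of "{y}"] .
    have "(LINT x|P. S i (\<tau> x) * h x) =
      (LINT x|P. (\<Sum>y \<in> S i ` space M. y * (indicator (\<tau> -` ?A y \<inter> space P) x *\<^sub>R h x)))"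
    proof (rule Bochner_Integration.integral_cong[OF refl])
      fix x assume x: "x \<in> space P"
      then have tx: "\<tau> x \<in> space M" by (rule measurable_space[OF t])
      have "S i (\<tau> x) = (\<Sum>y \<in> S i ` space M. indicator (?A y) (\<tau> x) *\<^sub>R y)"
        by (rule simple_function_indicator_representation_banach[OF S(1) tx])
      then have "S i (\<tau> x) * h x = (\<Sum>y \<in> S i ` space M. (indicator (?A y) (\<tau> x) *\<^sub>R y) * h x)"
        by (simp only: sum_distrib_right)
      also have "\<dots> = (\<Sum>y \<in> S i ` space M. y * (indicator (\<tau> -` ?A y \<inter> space P) x *\<^sub>R h x))"
        using x tx by (intro sum.cong) (auto simp: indicator_def)
      finally show "S i (\<tau> x) * h x = \<dots>" .
    qed
    also have "\<dots> = (\<Sum>y \<in> S i ` space M. (LINT x|P. y * (indicator (\<tau> -` ?A y \<inter> space P) x *\<^sub>R h x)))"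
      by (rule Bochner_Integration.integral_sum)
        (intro integrable_mult_right integrable_mult_indicator h measurable_sets[OF t A])
    also have "\<dots> = (\<Sum>y \<in> S i ` space M. y * (LINT x:(\<tau> -` ?A y \<inter> space P)|P. h x))"
      unfolding set_lebesgue_integral_def by (intro sum.cong refl integral_mult_right_zero)
    finally show ?thesis .
  qed
  have "(LINT x|P1. S i (\<tau>1 x) * h1 x) = (LINT x|P2. S i (\<tau>2 x) * h2 x)" for i
    unfolding simp[OF \<tau>1 h1] simp[OF \<tau>2 h2] 
    by (intro sum.cong refl arg_cong2[where f="(*)"] eq simple_functionD(2)[OF S(1)])
  then have "(\<lambda>i. LINT x|P1. S i (\<tau>1 x) * h1 x) \<longlonglongrightarrow> (LINT x|P2. g (\<tau>2 x) * h2 x)"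
    using lim[OF \<tau>2 h2] by simp
  with lim[OF \<tau>1 h1] show ?thesis by (rule LIMSEQ_unique)
qed

section \<open>Injectivity of the Laplace transform\<close>

text \<open>The value of \<open>char\<close> at \<open>0\<close> is the total mass, so both measures
  have the same mass and can be normalised to probability distributions, where Levy's uniqueness
  theorem applies. Mass \<open>0\<close> cannot be normalised and is treated separately.\<close>

lemma finite_measure_char_unique:
  assumes M: "finite_measure M" "sets M = sets (borel :: real measure)"
    and N: "finite_measure N" "sets N = sets (borel :: real measure)"
    and eq: "char M = char N"
  shows "M = N"
proof -
  interpret M: finite_measure M by fact
  interpret N: finite_measure N by fact
  have sp: "space M = UNIV" "space N = UNIV"
    using sets_eq_imp_space_eq[OF M(2)] sets_eq_imp_space_eq[OF N(2)] by simp_all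
  define m where "m = measure M UNIV"
  have char0: "char K 0 = complex_of_real (measure K UNIV)" if "space K = UNIV" for K
    using that by (simp add: char_def scaleR_conv_of_real)
  have m': "m = measure N UNIV"
    using fun_cong[OF eq, of 0] unfolding char0[OF sp(1)] char0[OF sp(2)] m_def by simp
  show ?thesis
  proof (cases "m = 0")
    case True
    have "emeasure K A = 0" if "finite_measure K" "space K = UNIV" "measure K UNIV = 0" for K and A :: "real set"
    proof -
      interpret K: finite_measure K by fact
      have "emeasure K A \<le> emeasure K (space K)" by (rule emeasure_space)
      also have "\<dots> = 0" using that by (simp add: K.emeasure_eq_measure)
      finally show ?thesis by simp
    qed
    then show ?thesis using True m' M N sp by (intro measure_eqI) (auto simp: m_def)
  next
    case False
    then have m: "m > 0" by (simp add: m_def zero_less_measure_iff)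
    define c where "c = 1 / m"
    have c: "c > 0" using m by (simp add: c_def)
    have dist: "real_distribution (density K (\<lambda>_. ennreal c))"
      if "finite_measure K" "sets K = sets borel" "space K = UNIV" "measure K UNIV = m" for K
    proof -
      interpret K: finite_measure K by fact
      have "emeasure (density K (\<lambda>_. ennreal c)) (space K) = 1"
        using that c m by (subst emeasure_density_const)
          (auto simp: K.emeasure_eq_measure ennreal_mult[symmetric] c_def)
      then have "prob_space (density K (\<lambda>_. ennreal c))" by (intro prob_spaceI) simp
      then show ?thesis using that
        by (simp add: real_distribution_def real_distribution_axioms_def)
    qed
    have "char (density K (\<lambda>_. ennreal c)) t = c *\<^sub>R char K t" if "sets K = sets borel" for K t
    proof -
      have "(\<lambda>x. iexp (t * x)) \<in> borel_measurable K"
        unfolding measurable_cong_sets[OF that refl] by measurable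
      then show ?thesis unfolding char_def using c by (subst integral_density) auto
    qed
    then have "char (density M (\<lambda>_. ennreal c)) = char (density N (\<lambda>_. ennreal c))"
      using eq M N by (auto simp: fun_eq_iff)
    then have *: "density M (\<lambda>_. ennreal c) = density N (\<lambda>_. ennreal c)"
      using M N sp m' by (intro Levy_uniqueness dist) (auto simp: m_def)
    show ?thesis
    proof (rule measure_eqI)
      fix A assume A: "A \<in> sets M"
      have "ennreal c * emeasure M A = ennreal c * emeasure N A"
        using arg_cong[OF *, of "\<lambda>K. emeasure K A"] A M N by (simp add: emeasure_density_const)
      then show "emeasure M A = emeasure N A"
        using c by (simp add: ennreal_mult_cancel_left)
    qed (use M N in simp)
  qed
qed

text \<open>Uniqueness for characteristic functions concerns positive measures. Writing both signed
  measures as positive minus negative part, the negative parts are moved across the equation; the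
  resulting sides \<open>\<alpha>\<close> and \<open>\<beta>\<close> are finite positive
  measures.\<close>

lemma fourier_unique:
  fixes r1 :: "'a \<Rightarrow> real" and r2 :: "'b \<Rightarrow> real"
  assumes \<tau>1[measurable]: "\<tau>1 \<in> borel_measurable P1" and \<tau>2[measurable]: "\<tau>2 \<in> borel_measurable P2"
    and r1: "integrable P1 r1" and r2: "integrable P2 r2"
    and eq: "\<And>t. (LINT x|P1. iexp (t * \<tau>1 x) * of_real (r1 x)) = (LINT x|P2. iexp (t * \<tau>2 x) * of_real (r2 x))"
    and A: "A \<in> sets (borel :: real measure)"
  shows "(LINT x:(\<tau>1 -` A \<inter> space P1)|P1. r1 x) = (LINT x:(\<tau>2 -` A \<inter> space P2)|P2. r2 x)"
proof -
  \<comment> \<open>The sign \<open>s\<close> is \<open>1\<close> for the positive part and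
    \<open>-1\<close> for the negative part.\<close>
  define N1 where "N1 s = distr (density P1 (\<lambda>x. ennreal (max (s * r1 x) 0))) borel \<tau>1" for s
  define N2 where "N2 s = distr (density P2 (\<lambda>x. ennreal (max (s * r2 x) 0))) borel \<tau>2" for s
  have fin: "finite_measure (distr (density P (\<lambda>x. ennreal (max (s * r x) 0))) borel \<tau>)"
    if [measurable]: "\<tau> \<in> borel_measurable P" and r: "integrable P r"
    for P :: "'c measure" and \<tau> :: "'c \<Rightarrow> real" and r s
  proof -
    have [measurable]: "r \<in> borel_measurable P" using r by simp
    have "integrable P (\<lambda>x. max (s * r x) 0)" using r by auto
    then have "(\<integral>\<^sup>+ x. ennreal (max (s * r x) 0) \<partial>P) < \<infinity>"
      by (subst nn_integral_eq_integral) auto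
    then have "finite_measure (density P (\<lambda>x. ennreal (max (s * r x) 0)))"
      by (intro finite_measureI) (auto simp: emeasure_density cong: nn_integral_cong)
    then show ?thesis by (rule finite_measure.finite_measure_distr) simp
  qed
  have int: "integrable (distr (density P (\<lambda>x. ennreal (max (s * r x) 0))) borel \<tau>) g"
      "integral\<^sup>L (distr (density P (\<lambda>x. ennreal (max (s * r x) 0))) borel \<tau>) g
        = (LINT x|P. max (s * r x) 0 *\<^sub>R g (\<tau> x))"
      "integrable P (\<lambda>x. max (s * r x) 0 *\<^sub>R g (\<tau> x))"
    if [measurable]: "\<tau> \<in> borel_measurable P" and r: "integrable P r"
      and g[measurable]: "g \<in> borel_measurable borel" and b: "\<And>x. norm (g x) \<le> 1"
    for P :: "'c measure" and \<tau> :: "'c \<Rightarrow> real" and r s and g :: "real \<Rightarrow> complex"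
  proof -
    interpret F: finite_measure "distr (density P (\<lambda>x. ennreal (max (s * r x) 0))) borel \<tau>"
      by (rule fin) fact+
    show "integrable (distr (density P (\<lambda>x. ennreal (max (s * r x) 0))) borel \<tau>) g"
      using b by (intro F.integrable_const_bound[of _ 1]) auto
    have [measurable]: "r \<in> borel_measurable P" using r by simp
    show "integral\<^sup>L (distr (density P (\<lambda>x. ennreal (max (s * r x) 0))) borel \<tau>) g
        = (LINT x|P. max (s * r x) 0 *\<^sub>R g (\<tau> x))"
      by (subst integral_distr, simp, simp, subst integral_density) auto
    show "integrable P (\<lambda>x. max (s * r x) 0 *\<^sub>R g (\<tau> x))"
    proof (rule Bochner_Integration.integrable_bound)
      show "integrable P (\<lambda>x. max (s * r x) 0)" using r by auto
      show "AE x in P. norm (max (s * r x) 0 *\<^sub>R g (\<tau> x)) \<le> norm (max (s * r x) 0)"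
        using b by (intro AE_I2) (simp add: mult_left_le)
    qed measurable
  qed
  define \<alpha> where "\<alpha> = add_measure (N1 1) (N2 (-1))"
  define \<beta> where "\<beta> = add_measure (N2 1) (N1 (-1))"
  have s: "sets (N1 s) = sets borel" "sets (N2 s) = sets borel" for s
    by (simp_all add: N1_def N2_def)
  have finN: "finite_measure (N1 s)" "finite_measure (N2 s)" for s
    unfolding N1_def N2_def by (rule fin[OF \<tau>1 r1] fin[OF \<tau>2 r2])+
  have diff: "(LINT x|P. max (1 * r x) 0 *\<^sub>R g (\<tau> x)) - (LINT x|P. max (-1 * r x) 0 *\<^sub>R g (\<tau> x))
      = (LINT x|P. g (\<tau> x) * of_real (r x))"
    if "\<tau> \<in> borel_measurable P" "integrable P r" "g \<in> borel_measurable borel" "\<And>x. norm (g x) \<le> 1"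
    for P :: "'c measure" and \<tau> :: "'c \<Rightarrow> real" and r and g :: "real \<Rightarrow> complex"
    unfolding Bochner_Integration.integral_diff[OF int(3)[OF that] int(3)[OF that], symmetric]
    by (intro Bochner_Integration.integral_cong) (auto simp: scaleR_conv_of_real max_def)
  have add: "integral\<^sup>L \<alpha> g = integral\<^sup>L (N1 1) g + integral\<^sup>L (N2 (-1)) g"
      "integral\<^sup>L \<beta> g = integral\<^sup>L (N2 1) g + integral\<^sup>L (N1 (-1)) g"
    if g: "g \<in> borel_measurable borel" "\<And>x. norm (g x) \<le> 1" for g :: "real \<Rightarrow> complex"
  proof -
    have "integrable (N1 s) g" "integrable (N2 s) g" for s
      unfolding N1_def N2_def using int(1)[OF \<tau>1 r1 g] int(1)[OF \<tau>2 r2 g] by auto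
    then show "integral\<^sup>L \<alpha> g = integral\<^sup>L (N1 1) g + integral\<^sup>L (N2 (-1)) g"
      "integral\<^sup>L \<beta> g = integral\<^sup>L (N2 1) g + integral\<^sup>L (N1 (-1)) g"
      unfolding \<alpha>_def \<beta>_def using s
      by (auto intro!: has_bochner_integral_integral_eq has_bochner_integral_add_measure)
  qed
  have "char \<alpha> = char \<beta>"
  proof
    fix t
    let ?g = "\<lambda>x. iexp (t * x)"
    have g: "?g \<in> borel_measurable borel" "\<And>x. norm (?g x) \<le> 1" by auto
    have "char \<alpha> t = integral\<^sup>L (N1 1) ?g + integral\<^sup>L (N2 (-1)) ?g"
      unfolding char_def by (rule add(1)[OF g])
    moreover have "char \<beta> t = integral\<^sup>L (N2 1) ?g + integral\<^sup>L (N1 (-1)) ?g"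
      unfolding char_def by (rule add(2)[OF g])
    moreover have "integral\<^sup>L (N1 1) ?g - integral\<^sup>L (N1 (-1)) ?g = integral\<^sup>L (N2 1) ?g - integral\<^sup>L (N2 (-1)) ?g"
      unfolding N1_def N2_def int(2)[OF \<tau>1 r1 g] int(2)[OF \<tau>2 r2 g] diff[OF \<tau>1 r1 g] diff[OF \<tau>2 r2 g]
      by (rule eq)
    ultimately show "char \<alpha> t = char \<beta> t" by (simp add: algebra_simps)
  qed
  then have "\<alpha> = \<beta>"
    using s finN unfolding \<alpha>_def \<beta>_def
    by (intro finite_measure_char_unique finite_measure_add_measure) auto
  have g: "(indicator A :: real \<Rightarrow> complex) \<in> borel_measurable borel" "\<And>x. norm (indicator A x :: complex) \<le> 1"
    by (rule borel_measurable_indicator[OF A]) (simp split: split_indicator)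
  have "integral\<^sup>L (N1 1) (indicator A :: real \<Rightarrow> complex) - integral\<^sup>L (N1 (-1)) (indicator A)
     = integral\<^sup>L (N2 1) (indicator A) - integral\<^sup>L (N2 (-1)) (indicator A)"
  proof -
    have "integral\<^sup>L (N1 1) (indicator A :: real \<Rightarrow> complex) + integral\<^sup>L (N2 (-1)) (indicator A)
       = integral\<^sup>L (N2 1) (indicator A) + integral\<^sup>L (N1 (-1)) (indicator A)"
      using add[OF g] unfolding \<open>\<alpha> = \<beta>\<close> by (rule trans[OF sym])
    then show ?thesis by (simp add: diff_eq_eq) (simp add: algebra_simps)
  qed
  then have *: "(LINT x|P1. indicator A (\<tau>1 x) * complex_of_real (r1 x)) = (LINT x|P2. indicator A (\<tau>2 x) * of_real (r2 x))"
    unfolding N1_def N2_def int(2)[OF \<tau>1 r1 g] int(2)[OF \<tau>2 r2 g] diff[OF \<tau>1 r1 g] diff[OF \<tau>2 r2 g] .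
  have **: "(LINT x|P. indicator A (\<tau> x) * complex_of_real (r x)) = of_real (LINT x:(\<tau> -` A \<inter> space P)|P. r x)"
    for P :: "'c measure" and \<tau> :: "'c \<Rightarrow> real" and r
    unfolding set_lebesgue_integral_def integral_complex_of_real[symmetric]
    by (intro Bochner_Integration.integral_cong) (auto simp: indicator_def)
  show ?thesis using * unfolding ** of_real_eq_iff .
qed

lemma norm_exp_minus_le_1: "0 \<le> t \<Longrightarrow> 0 \<le> Re z \<Longrightarrow> norm (exp (- (complex_of_real t * z))) \<le> 1"
  by simp

lemma integrable_laplace:
  fixes h :: "'a \<Rightarrow> complex"
  assumes [measurable]: "\<tau> \<in> borel_measurable P" and pos: "\<And>x. x \<in> space P \<Longrightarrow> 0 \<le> \<tau> x"
    and h: "integrable P h" and z: "0 \<le> Re z"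
  shows "integrable P (\<lambda>x. exp (- (complex_of_real (\<tau> x) * z)) * h x)"
proof (rule Bochner_Integration.integrable_bound[OF h])
  have [measurable]: "h \<in> borel_measurable P" using h by simp
  show "(\<lambda>x. exp (- (complex_of_real (\<tau> x) * z)) * h x) \<in> borel_measurable P" by measurable
  show "AE x in P. norm (exp (- (complex_of_real (\<tau> x) * z)) * h x) \<le> norm (h x)"
    using pos z norm_exp_minus_le_1[of _ z]
    by (intro AE_I2) (simp only: norm_mult mult_left_le_one_le norm_ge_zero)
qed

text \<open>Averaging the transform at \<open>z\<close> with the conjugate of its value at
  \<open>cnj z\<close> isolates the real part of the density. Along
  \<open>1 / Suc n - \<i> * t\<close> the result tends to a Fourier transform by dominated
  convergence, since the exponentials are bounded by \<open>1\<close> for nonnegative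
  \<open>\<tau>\<close>.\<close>

lemma laplace_unique_Re:
  fixes h1 :: "'a \<Rightarrow> complex" and h2 :: "'b \<Rightarrow> complex"
  assumes \<tau>1[measurable]: "\<tau>1 \<in> borel_measurable P1" and pos1: "\<And>x. x \<in> space P1 \<Longrightarrow> 0 \<le> \<tau>1 x"
    and \<tau>2[measurable]: "\<tau>2 \<in> borel_measurable P2" and pos2: "\<And>x. x \<in> space P2 \<Longrightarrow> 0 \<le> \<tau>2 x"
    and h1: "integrable P1 h1" and h2: "integrable P2 h2"
    and eq: "\<And>z. Re z > 0 \<Longrightarrow> (LINT x|P1. exp (- (complex_of_real (\<tau>1 x) * z)) * h1 x)
      = (LINT x|P2. exp (- (complex_of_real (\<tau>2 x) * z)) * h2 x)"
    and A: "A \<in> sets (borel :: real measure)"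
  shows "(LINT x:(\<tau>1 -` A \<inter> space P1)|P1. Re (h1 x)) = (LINT x:(\<tau>2 -` A \<inter> space P2)|P2. Re (h2 x))"
proof (rule fourier_unique[OF \<tau>1 \<tau>2 integrable_Re[OF h1] integrable_Re[OF h2] _ A])
  fix t :: real
  let ?L = "\<lambda>P \<tau> h z. LINT x|P. exp (- (complex_of_real (\<tau> x) * z)) * h x"
  have Re: "?L P \<tau> (\<lambda>x. of_real (Re (h x))) z = (?L P \<tau> h z + cnj (?L P \<tau> h (cnj z))) / 2"
    if "\<tau> \<in> borel_measurable P" "\<And>x. x \<in> space P \<Longrightarrow> 0 \<le> \<tau> x" "integrable P h" "Re z > 0"
    for P :: "'c measure" and \<tau> h z
  proof -
    have "?L P \<tau> (\<lambda>x. of_real (Re (h x))) z =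
      (LINT x|P. (exp (- (complex_of_real (\<tau> x) * z)) * h x + cnj (exp (- (complex_of_real (\<tau> x) * cnj z)) * h x)) / 2)"
      by (intro Bochner_Integration.integral_cong)
        (simp_all add: exp_cnj distrib_left[symmetric] complex_add_cnj)
    also have "\<dots> = (?L P \<tau> h z + cnj (?L P \<tau> h (cnj z))) / 2"
      using that integrable_laplace[OF that(1,2,3), of z] integrable_laplace[OF that(1,2,3), of "cnj z"]
      by (simp add: integral_cnj[symmetric] del: complex_cnj_mult)
    finally show ?thesis .
  qed
  have lim: "(\<lambda>n. ?L P \<tau> (\<lambda>x. of_real (Re (h x))) (of_real (1 / Suc n) - \<i> * t))
      \<longlonglongrightarrow> (LINT x|P. iexp (t * \<tau> x) * of_real (Re (h x)))"
    if [measurable]: "\<tau> \<in> borel_measurable P" and pos: "\<And>x. x \<in> space P \<Longrightarrow> 0 \<le> \<tau> x" and h: "integrable P h"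
    for P :: "'c measure" and \<tau> h
  proof (rule integral_dominated_convergence)
    have [measurable]: "h \<in> borel_measurable P" using h by simp
    show "integrable P (\<lambda>x. norm (h x))" using h by simp
    show "(\<lambda>x. iexp (t * \<tau> x) * of_real (Re (h x))) \<in> borel_measurable P" by measurable
    show "(\<lambda>x. exp (- (complex_of_real (\<tau> x) * (of_real (1 / Suc n) - \<i> * t))) * of_real (Re (h x))) \<in> borel_measurable P" for n
      by measurable
    show "AE x in P. (\<lambda>n. exp (- (complex_of_real (\<tau> x) * (of_real (1 / Suc n) - \<i> * t))) * of_real (Re (h x)))
        \<longlonglongrightarrow> iexp (t * \<tau> x) * of_real (Re (h x))"
    proof (rule AE_I2)
      fix x
      have "(\<lambda>n. 1 / real (Suc n)) \<longlonglongrightarrow> 0" using LIMSEQ_inverse_real_of_nat by (simp add: field_simps)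
      then have "(\<lambda>n. exp (- (complex_of_real (\<tau> x) * (of_real (1 / Suc n) - \<i> * t))) * of_real (Re (h x)))
        \<longlonglongrightarrow> exp (- (complex_of_real (\<tau> x) * (of_real 0 - \<i> * t))) * of_real (Re (h x))"
        by (intro tendsto_intros)
      then show "(\<lambda>n. exp (- (complex_of_real (\<tau> x) * (of_real (1 / Suc n) - \<i> * t))) * of_real (Re (h x)))
        \<longlonglongrightarrow> iexp (t * \<tau> x) * of_real (Re (h x))" by (simp add: mult_ac)
    qed
    show "AE x in P. norm (exp (- (complex_of_real (\<tau> x) * (of_real (1 / Suc n) - \<i> * t))) * of_real (Re (h x))) \<le> norm (h x)" for n
    proof (rule AE_I2)
      fix x assume "x \<in> space P"
      then have "norm (exp (- (complex_of_real (\<tau> x) * (of_real (1 / Suc n) - \<i> * t)))) \<le> 1"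
        using pos by (intro norm_exp_minus_le_1) auto
      then have "norm (exp (- (complex_of_real (\<tau> x) * (of_real (1 / Suc n) - \<i> * t)))) * norm (complex_of_real (Re (h x))) \<le> 1 * norm (h x)"
        by (intro mult_mono) (auto simp: abs_Re_le_cmod)
      then show "norm (exp (- (complex_of_real (\<tau> x) * (of_real (1 / Suc n) - \<i> * t))) * of_real (Re (h x))) \<le> norm (h x)"
        by (simp only: norm_mult mult_1)
    qed
  qed
  have "?L P1 \<tau>1 (\<lambda>x. of_real (Re (h1 x))) (of_real (1 / Suc n) - \<i> * t) = ?L P2 \<tau>2 (\<lambda>x. of_real (Re (h2 x))) (of_real (1 / Suc n) - \<i> * t)" for n
    using eq by (subst Re[OF \<tau>1 pos1 h1], simp, simp, subst Re[OF \<tau>2 pos2 h2]) auto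
  with lim[OF \<tau>1 pos1 h1] lim[OF \<tau>2 pos2 h2]
  show "(LINT x|P1. iexp (t * \<tau>1 x) * of_real (Re (h1 x))) = (LINT x|P2. iexp (t * \<tau>2 x) * of_real (Re (h2 x)))"
    by (auto intro: LIMSEQ_unique)
qed

text \<open>The real part of \<open>- \<i> * h\<close> is the imaginary part of \<open>h\<close>, so
  the result for real parts is used twice.\<close>

lemma laplace_unique:
  fixes h1 :: "'a \<Rightarrow> complex" and h2 :: "'b \<Rightarrow> complex"
  assumes \<tau>1[measurable]: "\<tau>1 \<in> borel_measurable P1" and pos1: "\<And>x. x \<in> space P1 \<Longrightarrow> 0 \<le> \<tau>1 x"
    and \<tau>2[measurable]: "\<tau>2 \<in> borel_measurable P2" and pos2: "\<And>x. x \<in> space P2 \<Longrightarrow> 0 \<le> \<tau>2 x"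
    and h1: "integrable P1 h1" and h2: "integrable P2 h2"
    and eq: "\<And>z. Re z > 0 \<Longrightarrow> (LINT x|P1. exp (- (complex_of_real (\<tau>1 x) * z)) * h1 x)
      = (LINT x|P2. exp (- (complex_of_real (\<tau>2 x) * z)) * h2 x)"
    and A: "A \<in> sets (borel :: real measure)"
  shows "(LINT x:(\<tau>1 -` A \<inter> space P1)|P1. h1 x) = (LINT x:(\<tau>2 -` A \<inter> space P2)|P2. h2 x)"
proof -
  have eq': "(LINT x|P1. exp (- (complex_of_real (\<tau>1 x) * z)) * (- \<i> * h1 x))
      = (LINT x|P2. exp (- (complex_of_real (\<tau>2 x) * z)) * (- \<i> * h2 x))" if "Re z > 0" for z
    using arg_cong[OF eq[OF that], of "\<lambda>w. - \<i> * w"]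
    unfolding integral_mult_right_zero[symmetric] by (simp only: mult.left_commute)
  have i: "integrable P1 (\<lambda>x. - \<i> * h1 x)" "integrable P2 (\<lambda>x. - \<i> * h2 x)"
    using h1 h2 by (auto intro: integrable_mult_right)
  note Re = laplace_unique_Re[OF \<tau>1 pos1 \<tau>2 pos2 h1 h2 eq A]
  have Im: "(LINT x:(\<tau>1 -` A \<inter> space P1)|P1. Im (h1 x)) = (LINT x:(\<tau>2 -` A \<inter> space P2)|P2. Im (h2 x))"
    using laplace_unique_Re[OF \<tau>1 pos1 \<tau>2 pos2 i eq' A] by simp
  have ReIm: "Re (LINT x:B|P. h x) = (LINT x:B|P. Re (h x))" "Im (LINT x:B|P. h x) = (LINT x:B|P. Im (h x))"
    if "integrable P h" "B \<in> sets P" for B P and h :: "'c \<Rightarrow> complex"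
    using integral_Re[OF integrable_mult_indicator[OF that(2,1)]]
      integral_Im[OF integrable_mult_indicator[OF that(2,1)]]
    unfolding set_lebesgue_integral_def by simp_all
  have B: "\<tau>1 -` A \<inter> space P1 \<in> sets P1" "\<tau>2 -` A \<inter> space P2 \<in> sets P2"
    using A by (auto intro: measurable_sets)
  show ?thesis using Re Im by (simp add: complex_eq_iff ReIm[OF h1 B(1)] ReIm[OF h2 B(2)])
qed

section \<open>Elements of the algebra as Laplace integrals\<close>

lemma sets_half_lineD: "A \<in> sets half_line \<Longrightarrow> A \<in> sets borel"
  by (auto simp: sets_restrict_space_iff)

lemma sets_half_line_id:
  assumes "sets P = sets half_line"
  shows "space P = {0..}" "(\<lambda>x. x) \<in> borel_measurable P"
proof -
  show sp: "space P = {0..}" using sets_eq_imp_space_eq[OF assms] by (simp add: space_restrict_space)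
  show "(\<lambda>x. x) \<in> borel_measurable P"
    unfolding measurable_cong_sets[OF assms refl] by (rule measurable_restrict_space1) simp
qed

lemma laplace_of_density:
  assumes F: "laplace_of F \<mu>"
  obtains P h where "finite_measure P" "sets P = sets half_line" "integrable P h"
    "\<And>A. A \<in> sets half_line \<Longrightarrow> \<mu> A = (LINT x:A|P. h x)"
    "\<And>z. Re z > 0 \<Longrightarrow> F z = (LINT x|P. exp (- (complex_of_real x * z)) * h x)"
proof -
  have \<mu>: "complex_measure half_line \<mu>" and L: "\<And>z. Re z > 0 \<Longrightarrow> F z = laplace \<mu> z"
    using F by (auto simp: laplace_of_def)
  obtain P and h :: "real \<Rightarrow> complex" where P: "finite_measure P" "sets P = sets half_line" "integrable P h"
    "\<And>A. A \<in> sets half_line \<Longrightarrow> \<mu> A = (LINT x:A|P. h x)"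
    "\<And>g. g \<in> borel_measurable half_line \<Longrightarrow> bounded (g ` space half_line) \<Longrightarrow>
       complex_measure_integral half_line \<mu> g = (LINT x|P. g x * h x)"
    by (rule complex_measure_density[OF \<mu>]) blast
  have "F z = (LINT x|P. exp (- (complex_of_real x * z)) * h x)" if z: "Re z > 0" for z
  proof -
    have "bounded ((\<lambda>s. exp (- (complex_of_real s * z))) ` space half_line)"
      using z by (intro boundedI[of _ 1]) (auto simp: space_restrict_space)
    moreover have "(\<lambda>s. exp (- (complex_of_real s * z))) \<in> borel_measurable half_line"
      by (rule measurable_restrict_space1) measurable
    ultimately show ?thesis using L[OF z] P(5) by (simp add: laplace_def)
  qed
  with P(1-4) show thesis using that by blast
qed

lemma laplace_of_unique:
  assumes "laplace_of F \<mu>" "laplace_of F \<mu>'" and A: "A \<in> sets half_line"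
  shows "\<mu> A = \<mu>' A"
proof -
  obtain P h where P: "finite_measure P" "sets P = sets half_line" "integrable P h"
    "\<And>A. A \<in> sets half_line \<Longrightarrow> \<mu> A = (LINT x:A|P. h x)"
    "\<And>z. Re z > 0 \<Longrightarrow> F z = (LINT x|P. exp (- (complex_of_real x * z)) * h x)"
    by (rule laplace_of_density[OF assms(1)]) blast
  obtain P' h' where P': "finite_measure P'" "sets P' = sets half_line" "integrable P' h'"
    "\<And>A. A \<in> sets half_line \<Longrightarrow> \<mu>' A = (LINT x:A|P'. h' x)"
    "\<And>z. Re z > 0 \<Longrightarrow> F z = (LINT x|P'. exp (- (complex_of_real x * z)) * h' x)"
    by (rule laplace_of_density[OF assms(2)]) blast
  have "(LINT x:((\<lambda>x. x) -` A \<inter> space P)|P. h x) = (LINT x:((\<lambda>x. x) -` A \<inter> space P')|P'. h' x)"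
    using P(5) P'(5) sets_half_line_id[OF P(2)] sets_half_line_id[OF P'(2)]
    by (intro laplace_unique P(3) P'(3) sets_half_lineD[OF A]) auto
  moreover have "(\<lambda>x. x) -` A \<inter> space P = A" "(\<lambda>x. x) -` A \<inter> space P' = A"
    using sets.sets_into_space[OF A] sets_half_line_id[OF P(2)] sets_half_line_id[OF P'(2)]
    by (auto simp: space_restrict_space)
  ultimately show ?thesis using P(4)[OF A] P'(4)[OF A] by simp
qed

text \<open>Representing set functions are determined only on Borel subsets of the half-line and may
  differ elsewhere. The variation sees only such sets, so the description defining
  \<open>A1_norm\<close> is satisfied by exactly one number.\<close>

lemma A1_norm_eq:
  assumes "laplace_of F \<mu>"
  shows "A1_norm F = enn2real (variation half_line \<mu> {0..})"
proof -
  have *: "variation half_line \<mu>' {0..} = variation half_line \<mu> {0..}" if "laplace_of F \<mu>'" for \<mu>'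
    unfolding variation_def using laplace_of_unique[OF that assms]
    by (intro SUP_cong refl suminf_cong) (auto simp: image_subset_iff)
  show ?thesis
    unfolding A1_norm_def
  proof (rule the_equality)
    fix r assume "\<exists>\<mu>'. laplace_of F \<mu>' \<and> r = enn2real (variation half_line \<mu>' {0..})"
    then obtain \<mu>' where "laplace_of F \<mu>'" "r = enn2real (variation half_line \<mu>' {0..})" by blast
    then show "r = enn2real (variation half_line \<mu> {0..})" by (simp only: *)
  qed (use assms in blast)
qed

text \<open>Later estimates are computed from densities of given elements. They can be expressed
  through \<open>A1_norm\<close> because the variation is not smaller than the integral of the
  modulus of the density; this is where the lower bound in \<open>variation_density\<close>
  enters.\<close>

lemma A1_plus_density:
  assumes "F \<in> A1_plus"
  obtains P h where "finite_measure P" "sets P = sets half_line" "integrable P h"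
    "\<And>z. Re z > 0 \<Longrightarrow> F z = (LINT x|P. exp (- (complex_of_real x * z)) * h x)"
    "A1_norm F = (LINT x|P. norm (h x))"
proof -
  obtain \<mu> where \<mu>: "laplace_of F \<mu>" using assms by (auto simp: A1_plus_def)
  obtain P h where P: "finite_measure P" "sets P = sets half_line" "integrable P h"
    "\<And>A. A \<in> sets half_line \<Longrightarrow> \<mu> A = (LINT x:A|P. h x)"
    "\<And>z. Re z > 0 \<Longrightarrow> F z = (LINT x|P. exp (- (complex_of_real x * z)) * h x)"
    by (rule laplace_of_density[OF \<mu>]) blast
  have "variation half_line \<mu> {0..} = ennreal (LINT x|P. norm (h x))"
    using variation_density[OF P(2,3,4)] by (simp add: space_restrict_space)
  then have "A1_norm F = (LINT x|P. norm (h x))"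
    unfolding A1_norm_eq[OF \<mu>] by simp
  with P show thesis using that by blast
qed

lemma A1_norm_nonneg: "F \<in> A1_plus \<Longrightarrow> 0 \<le> A1_norm F"
  by (erule A1_plus_density) simp

text \<open>The representing measure is the image under \<open>\<tau>\<close> of the measure with
  density \<open>h\<close>, and taking images does not increase mass. A second density
  \<open>k\<close>, on the half-line, mediates because \<open>laplace\<close> is defined through the
  Jordan parts of the image and not through \<open>P\<close>.\<close>

lemma A1_plusI:
  assumes \<tau>[measurable]: "\<tau> \<in> borel_measurable P" and pos: "\<And>x. x \<in> space P \<Longrightarrow> 0 \<le> \<tau> x"
    and h: "integrable P h"
    and F: "\<And>z. Re z > 0 \<Longrightarrow> F z = (LINT x|P. exp (- (complex_of_real (\<tau> x) * z)) * h x)"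
  shows "F \<in> A1_plus" "A1_norm F \<le> (LINT x|P. norm (h x))"
proof -
  define \<mu> where "\<mu> A = (LINT x:(\<tau> -` A \<inter> space P)|P. h x)" for A
  have \<tau>': "\<tau> \<in> measurable P half_line"
    using pos by (intro measurable_restrict_space2) auto
  have \<mu>: "complex_measure half_line \<mu>"
    by (rule pushforward_complex_measure(1)[OF \<tau>' h]) (simp add: \<mu>_def)
  obtain Q and k :: "real \<Rightarrow> complex" where Q: "finite_measure Q" "sets Q = sets half_line" "integrable Q k"
    "\<And>A. A \<in> sets half_line \<Longrightarrow> \<mu> A = (LINT x:A|Q. k x)"
    "\<And>g. g \<in> borel_measurable half_line \<Longrightarrow> bounded (g ` space half_line) \<Longrightarrow>
       complex_measure_integral half_line \<mu> g = (LINT x|Q. g x * k x)"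
    by (rule complex_measure_density[OF \<mu>]) blast
  have L: "laplace_of F \<mu>"
    unfolding laplace_of_def
  proof (intro conjI \<mu> allI impI)
    fix z :: complex assume z: "Re z > 0"
    let ?g = "\<lambda>s. exp (- (complex_of_real s * z))"
    have b: "bounded (?g ` space half_line)"
      using z by (intro boundedI[of _ 1]) (auto simp: space_restrict_space)
    have m: "?g \<in> borel_measurable half_line"
      by (rule measurable_restrict_space1) measurable
    have id: "(\<lambda>x. x) \<in> measurable Q half_line"
      unfolding measurable_cong_sets[OF Q(2) refl] by simp
    have "(LINT x|P. ?g (\<tau> x) * h x) = (LINT x|Q. ?g x * k x)"
    proof (rule set_integrals_determine[OF \<tau>' id h Q(3) _ m b])
      fix A assume A: "A \<in> sets half_line"
      then have "(\<lambda>x. x) -` A \<inter> space Q = A"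
        using sets.sets_into_space[OF A] sets_eq_imp_space_eq[OF Q(2)] by auto
      then show "(LINT x:(\<tau> -` A \<inter> space P)|P. h x) = (LINT x:((\<lambda>x. x) -` A \<inter> space Q)|Q. k x)"
        using Q(4)[OF A] by (simp add: \<mu>_def)
    qed
    also have "\<dots> = laplace \<mu> z" unfolding laplace_def by (rule Q(5)[OF m b, symmetric])
    finally show "F z = laplace \<mu> z" using F[OF z] by simp
  qed
  then show "F \<in> A1_plus" by (auto simp: A1_plus_def)
  have "variation half_line \<mu> {0..} \<le> ennreal (LINT x|P. norm (h x))"
    by (rule pushforward_complex_measure(2)[OF \<tau>' h]) (simp add: \<mu>_def)
  then show "A1_norm F \<le> (LINT x|P. norm (h x))"
    unfolding A1_norm_eq[OF L] by (intro enn2real_leI) simp_all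
qed

section \<open>Linear operations and point evaluations on the algebra\<close>

lemma A1_plus_cong:
  assumes "\<And>z. Re z > 0 \<Longrightarrow> F z = G z"
  shows "F \<in> A1_plus \<longleftrightarrow> G \<in> A1_plus" "A1_norm F = A1_norm G"
proof -
  have "laplace_of F = laplace_of G" using assms by (auto simp: laplace_of_def fun_eq_iff)
  then show "F \<in> A1_plus \<longleftrightarrow> G \<in> A1_plus" "A1_norm F = A1_norm G"
    by (simp_all add: A1_plus_def A1_norm_def)
qed

text \<open>The exponentials have modulus at most \<open>1\<close>. Values thus become lower bounds
  for norms, which is used for \<open>c_const\<close> and for elements of norm
  \<open>0\<close>.\<close>

lemma A1_norm_bound:
  assumes "F \<in> A1_plus" "Re z > 0"
  shows "norm (F z) \<le> A1_norm F"
proof -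
  obtain P h where P: "finite_measure P" "sets P = sets half_line" "integrable P h"
    "\<And>z. Re z > 0 \<Longrightarrow> F z = (LINT x|P. exp (- (complex_of_real x * z)) * h x)"
    "A1_norm F = (LINT x|P. norm (h x))"
    by (rule A1_plus_density[OF assms(1)]) blast
  have "norm (F z) \<le> (LINT x|P. norm (exp (- (complex_of_real x * z)) * h x))"
    unfolding P(4)[OF assms(2)] by (rule integral_norm_bound)
  also have "\<dots> \<le> (LINT x|P. norm (h x))"
  proof (rule integral_mono)
    show "integrable P (\<lambda>x. norm (exp (- (complex_of_real x * z)) * h x))"
      using sets_half_line_id[OF P(2)] P(3) assms(2) by (intro integrable_norm integrable_laplace) auto
    show "norm (exp (- (complex_of_real x * z)) * h x) \<le> norm (h x)" if "x \<in> space P" for x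
      using that sets_half_line_id[OF P(2)] norm_exp_minus_le_1[of x z] assms(2)
      by (simp only: norm_mult) (simp add: mult_left_le_one_le)
  qed (use P(3) in simp)
  finally show ?thesis using P(5) by simp
qed

text \<open>Tagging the two measures realises a sum of Laplace integrals as one Laplace integral.\<close>

lemma A1_plus_add:
  assumes F: "F \<in> A1_plus" and G: "G \<in> A1_plus"
  shows "(\<lambda>z. F z + G z) \<in> A1_plus" "A1_norm (\<lambda>z. F z + G z) \<le> A1_norm F + A1_norm G"
proof -
  obtain P h where P: "finite_measure P" "sets P = sets half_line" "integrable P h"
    "\<And>z. Re z > 0 \<Longrightarrow> F z = (LINT x|P. exp (- (complex_of_real x * z)) * h x)"
    "A1_norm F = (LINT x|P. norm (h x))"
    by (rule A1_plus_density[OF F]) blast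
  obtain Q k where Q: "finite_measure Q" "sets Q = sets half_line" "integrable Q k"
    "\<And>z. Re z > 0 \<Longrightarrow> G z = (LINT x|Q. exp (- (complex_of_real x * z)) * k x)"
    "A1_norm G = (LINT x|Q. norm (k x))"
    by (rule A1_plus_density[OF G]) blast
  define S where "S = count_space (UNIV :: bool set) \<Otimes>\<^sub>M half_line"
  have tP[measurable]: "Pair True \<in> measurable P S" and tQ[measurable]: "Pair False \<in> measurable Q S"
    unfolding S_def measurable_cong_sets[OF P(2) refl] measurable_cong_sets[OF Q(2) refl]
    by measurable
  define N where "N = add_measure (distr P S (Pair True)) (distr Q S (Pair False))"
  define H where "H = (\<lambda>(b, x). if b then h x else k x)"
  have hm: "h \<in> borel_measurable half_line" "k \<in> borel_measurable half_line"
    using borel_measurable_integrable[OF P(3)] borel_measurable_integrable[OF Q(3)]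
    unfolding measurable_cong_sets[OF P(2) refl] measurable_cong_sets[OF Q(2) refl] .
  have Hm[measurable]: "H \<in> borel_measurable S"
    unfolding S_def H_def using hm by measurable
  have int: "has_bochner_integral N f ((LINT x|P. f (True, x)) + (LINT x|Q. f (False, x)))"
    if [measurable]: "f \<in> borel_measurable S" and "integrable P (\<lambda>x. f (True, x))" "integrable Q (\<lambda>x. f (False, x))"
    for f :: "_ \<Rightarrow> complex"
    using has_bochner_integral_add_measure[of "distr Q S (Pair False)" "distr P S (Pair True)" f] that
    unfolding N_def by (simp add: integrable_distr_eq integral_distr)
  have Hi: "integrable N H"
    using int[OF Hm] P(3) Q(3) by (auto simp: H_def has_bochner_integral_iff)
  have sm[measurable]: "snd \<in> borel_measurable S"
    unfolding S_def by (rule measurable_compose[OF measurable_snd measurable_restrict_space1]) simp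
  have sN: "sets N = sets S" "space N = UNIV \<times> {0..}"
    unfolding N_def by (simp_all add: S_def space_pair_measure space_restrict_space)
  have lap: "F z + G z = (LINT x|N. exp (- (complex_of_real (snd x) * z)) * H x)" if z: "Re z > 0" for z
  proof -
    let ?e = "\<lambda>x. exp (- (complex_of_real x * z))"
    let ?f = "\<lambda>x. ?e (snd x) * H x"
    have i: "integrable P (\<lambda>x. ?e x * h x)" "integrable Q (\<lambda>x. ?e x * k x)"
      by (rule integrable_laplace[OF sets_half_line_id(2)[OF P(2)] _ P(3)]
            integrable_laplace[OF sets_half_line_id(2)[OF Q(2)] _ Q(3)];
          use z sets_half_line_id(1)[OF P(2)] sets_half_line_id(1)[OF Q(2)] in simp)+
    have TF: "(\<lambda>x. ?f (True, x)) = (\<lambda>x. ?e x * h x)" "(\<lambda>x. ?f (False, x)) = (\<lambda>x. ?e x * k x)"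
      by (simp_all add: H_def)
    have "?f \<in> borel_measurable S" by measurable
    then have "has_bochner_integral N ?f ((LINT x|P. ?f (True, x)) + (LINT x|Q. ?f (False, x)))"
      by (rule int) (unfold TF, rule i, rule i)
    then have "integral\<^sup>L N ?f = (LINT x|P. ?e x * h x) + (LINT x|Q. ?e x * k x)"
      unfolding TF by (rule has_bochner_integral_integral_eq)
    then show ?thesis using P(4)[OF z] Q(4)[OF z] by simp
  qed
  have snd: "snd \<in> borel_measurable N" unfolding measurable_cong_sets[OF sN(1) refl] by (rule sm)
  have pos: "0 \<le> snd x" if "x \<in> space N" for x
    using that unfolding sN(2) by (simp add: mem_Times_iff)
  show "(\<lambda>z. F z + G z) \<in> A1_plus"
    by (rule A1_plusI(1)[OF snd pos Hi lap])
  have "A1_norm (\<lambda>z. F z + G z) \<le> (LINT x|N. norm (H x))"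
    by (rule A1_plusI(2)[OF snd pos Hi lap])
  also have "(LINT x|N. norm (H x)) = (LINT x|P. norm (h x)) + (LINT x|Q. norm (k x))"
  proof -
    \<comment> \<open>Only complex-valued functions are covered by \<open>int\<close>, so the
      modulus is embedded into the complex numbers.\<close>
    let ?f = "\<lambda>x. complex_of_real (norm (H x))"
    have TF: "(\<lambda>x. ?f (True, x)) = (\<lambda>x. of_real (norm (h x)))" "(\<lambda>x. ?f (False, x)) = (\<lambda>x. of_real (norm (k x)))"
      by (simp_all add: H_def)
    have "?f \<in> borel_measurable S" by measurable
    moreover have "integrable P (\<lambda>x. complex_of_real (norm (h x)))" "integrable Q (\<lambda>x. complex_of_real (norm (k x)))"
      using P(3) Q(3) by simp_all
    ultimately have "has_bochner_integral N ?f ((LINT x|P. ?f (True, x)) + (LINT x|Q. ?f (False, x)))"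
      by (intro int) (simp_all only: TF)
    then have "integral\<^sup>L N ?f = (LINT x|P. of_real (norm (h x))) + (LINT x|Q. of_real (norm (k x)))"
      unfolding TF by (rule has_bochner_integral_integral_eq)
    then show ?thesis unfolding integral_complex_of_real of_real_add[symmetric] of_real_eq_iff .
  qed
  also have "\<dots> = A1_norm F + A1_norm G" by (simp only: P(5) Q(5))
  finally show "A1_norm (\<lambda>z. F z + G z) \<le> A1_norm F + A1_norm G" .
qed

lemma A1_plus_cmult:
  assumes F: "F \<in> A1_plus"
  shows "(\<lambda>z. c * F z) \<in> A1_plus" "A1_norm (\<lambda>z. c * F z) \<le> norm c * A1_norm F"
proof -
  obtain P h where P: "finite_measure P" "sets P = sets half_line" "integrable P h"
    "\<And>z. Re z > 0 \<Longrightarrow> F z = (LINT x|P. exp (- (complex_of_real x * z)) * h x)"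
    "A1_norm F = (LINT x|P. norm (h x))"
    by (rule A1_plus_density[OF F]) blast
  have i: "integrable P (\<lambda>x. c * h x)" using P(3) by simp
  have l: "c * F z = (LINT x|P. exp (- (complex_of_real x * z)) * (c * h x))" if "Re z > 0" for z
    unfolding P(4)[OF that] integral_mult_right_zero[symmetric] by (simp add: mult.left_commute)
  have pos: "\<And>x. x \<in> space P \<Longrightarrow> 0 \<le> x" using sets_half_line_id(1)[OF P(2)] by auto
  show "(\<lambda>z. c * F z) \<in> A1_plus"
    by (rule A1_plusI(1)[OF sets_half_line_id(2)[OF P(2)] pos i l])
  have "A1_norm (\<lambda>z. c * F z) \<le> (LINT x|P. norm (c * h x))"
    by (rule A1_plusI(2)[OF sets_half_line_id(2)[OF P(2)] pos i l])
  then show "A1_norm (\<lambda>z. c * F z) \<le> norm c * A1_norm F"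
    by (simp add: P(5) norm_mult)
qed

text \<open>The representing measure is a point mass at the origin, realised on a one-point space
  with exponent \<open>0\<close>.\<close>

lemma A1_plus_const: "(\<lambda>z. c) \<in> A1_plus"
proof (rule A1_plusI(1))
  show "(\<lambda>_. 0) \<in> borel_measurable (count_space {()})" by simp
  show "integrable (count_space {()}) (\<lambda>_. c)" by (simp add: integrable_count_space)
  show "c = (LINT x|count_space {()}. exp (- (complex_of_real 0 * z)) * c)" for z
    by (subst lebesgue_integral_count_space_finite) auto
qed simp

section \<open>Analyticity\<close>

text \<open>Differentiation under the integral sign. Near \<open>z\<close> the real parts stay above
  \<open>\<delta> = Re z / 2\<close>, where the derivative of \<open>exp (- t w)\<close> in
  \<open>w\<close> has modulus at most \<open>1 / \<delta>\<close> for every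
  \<open>t \<ge> 0\<close>. A multiple of \<open>norm (h x)\<close> therefore dominates the
  difference quotients even if \<open>\<tau>\<close> is unbounded.\<close>

lemma laplace_integral_holomorphic:
  fixes h :: "'a \<Rightarrow> complex"
  assumes \<tau>[measurable]: "\<tau> \<in> borel_measurable P" and pos: "\<And>x. x \<in> space P \<Longrightarrow> 0 \<le> \<tau> x"
    and h: "integrable P h"
  shows "(\<lambda>z. LINT x|P. exp (- (complex_of_real (\<tau> x) * z)) * h x) holomorphic_on {z. Re z > 0}"
    (is "?f holomorphic_on _")
proof -
  have op: "open {z. Re z > c}" for c by (rule open_halfspace_Re_gt)
  have [measurable]: "h \<in> borel_measurable P" using h by simp
  have "?f field_differentiable at z" if z: "Re z > 0" for z
  proof -
    define \<delta> where "\<delta> = Re z / 2"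
    have \<delta>: "\<delta> > 0" "\<delta> < Re z" using z by (auto simp: \<delta>_def)
    let ?S = "{w. Re w > \<delta>}"
    let ?D = "LINT x|P. (- complex_of_real (\<tau> x) * exp (- (complex_of_real (\<tau> x) * z))) * h x"
    have bound: "norm (exp (- (complex_of_real t * w)) - exp (- (complex_of_real t * z))) \<le> 1 / \<delta> * norm (w - z)"
      if t: "0 \<le> t" and w: "w \<in> ?S" for t w
    proof (rule field_differentiable_bound[where S = ?S and f' = "\<lambda>w. - complex_of_real t * exp (- (complex_of_real t * w))"])
      show "convex ?S" by (rule convex_halfspace_Re_gt)
      show "((\<lambda>w. exp (- (complex_of_real t * w))) has_field_derivative
        - complex_of_real t * exp (- (complex_of_real t * v))) (at v within ?S)" for v
        by (auto intro!: derivative_eq_intros)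
      show "norm (- complex_of_real t * exp (- (complex_of_real t * v))) \<le> 1 / \<delta>" if "v \<in> ?S" for v
      proof -
        have "t * \<delta> \<le> t * Re v" using t that by (intro mult_left_mono) auto
        also have "\<dots> \<le> exp (t * Re v)" using exp_ge_add_one_self[of "t * Re v"] by linarith
        finally have "t * \<delta> * exp (- (t * Re v)) \<le> 1"
          by (simp add: exp_minus field_simps)
        then show ?thesis using \<delta> t by (simp add: norm_mult field_simps)
      qed
    qed (use w \<delta> in auto)
    have "((\<lambda>w. (?f w - ?f z) / (w - z)) \<longlongrightarrow> ?D) (at z within ?S)"
      unfolding tendsto_at_iff_sequentially comp_def
    proof (intro allI impI)
      fix X :: "nat \<Rightarrow> complex" assume X: "\<forall>i. X i \<in> ?S - {z}" "X \<longlonglongrightarrow> z"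
      let ?e = "\<lambda>x w. exp (- (complex_of_real (\<tau> x) * w))"
      have int: "integrable P (\<lambda>x. ?e x w * h x)" if "Re w > 0" for w
        using that by (intro integrable_laplace[OF \<tau> pos h]) auto
      have "(?f (X i) - ?f z) / (X i - z) = (LINT x|P. (?e x (X i) - ?e x z) / (X i - z) * h x)" for i
      proof -
        have "Re (X i) > 0" using X(1) \<delta> by (auto dest: spec[of _ i])
        then have "?f (X i) - ?f z = (LINT x|P. ?e x (X i) * h x - ?e x z * h x)"
          using int z by (intro Bochner_Integration.integral_diff[symmetric])
        then show ?thesis
          by (simp add: left_diff_distrib[symmetric] flip: integral_divide_zero)
      qed
      moreover have "(\<lambda>i. LINT x|P. (?e x (X i) - ?e x z) / (X i - z) * h x) \<longlonglongrightarrow> ?D"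
      proof (rule integral_dominated_convergence[where w = "\<lambda>x. 1 / \<delta> * norm (h x)"])
        show "integrable P (\<lambda>x. 1 / \<delta> * norm (h x))" using h by simp
        show "AE x in P. (\<lambda>i. (?e x (X i) - ?e x z) / (X i - z) * h x) \<longlonglongrightarrow> - complex_of_real (\<tau> x) * ?e x z * h x"
        proof (rule AE_I2)
          fix x
          have "((\<lambda>w. ?e x w) has_field_derivative - complex_of_real (\<tau> x) * ?e x z) (at z within ?S)"
            by (auto intro!: derivative_eq_intros)
          then have "((\<lambda>w. (?e x w - ?e x z) / (w - z)) \<longlongrightarrow> - complex_of_real (\<tau> x) * ?e x z) (at z within ?S)"
            by (simp add: has_field_derivative_iff)
          then have "(\<lambda>i. (?e x (X i) - ?e x z) / (X i - z)) \<longlonglongrightarrow> - complex_of_real (\<tau> x) * ?e x z"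
            unfolding tendsto_at_iff_sequentially comp_def using X by blast
          then show "(\<lambda>i. (?e x (X i) - ?e x z) / (X i - z) * h x) \<longlonglongrightarrow> - complex_of_real (\<tau> x) * ?e x z * h x"
            by (intro tendsto_mult tendsto_const)
        qed
        show "AE x in P. norm ((?e x (X i) - ?e x z) / (X i - z) * h x) \<le> 1 / \<delta> * norm (h x)" for i
        proof (rule AE_I2)
          fix x assume "x \<in> space P"
          then have "norm (?e x (X i) - ?e x z) \<le> 1 / \<delta> * norm (X i - z)" using X pos by (intro bound) auto
          moreover have "norm (X i - z) > 0" using X(1) by auto
          ultimately have "norm ((?e x (X i) - ?e x z) / (X i - z)) \<le> 1 / \<delta>"
            by (simp only: norm_divide pos_divide_le_eq)
          then show "norm ((?e x (X i) - ?e x z) / (X i - z) * h x) \<le> 1 / \<delta> * norm (h x)"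
            unfolding norm_mult[of _ "h x"] by (intro mult_right_mono) auto
        qed
      qed measurable
      ultimately show "(\<lambda>i. (?f (X i) - ?f z) / (X i - z)) \<longlonglongrightarrow> ?D" by (simp only:)
    qed
    then have "(?f has_field_derivative ?D) (at z within ?S)" by (simp add: has_field_derivative_iff)
    then have "(?f has_field_derivative ?D) (at z)" using \<delta> at_within_open[OF _ op, of z \<delta>] by simp
    then show ?thesis by (auto simp: field_differentiable_def)
  qed
  then show ?thesis using op[of 0] by (auto simp: holomorphic_on_def intro: field_differentiable_at_within)
qed

lemma A1_plus_holomorphic: "F \<in> A1_plus \<Longrightarrow> F holomorphic_on {z. Re z > 0}"
proof -
  assume "F \<in> A1_plus"
  then obtain P h where P: "finite_measure P" "sets P = sets half_line" "integrable P h"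
    "\<And>z. Re z > 0 \<Longrightarrow> F z = (LINT x|P. exp (- (complex_of_real x * z)) * h x)"
    by (rule A1_plus_density) blast
  have "(\<lambda>z. LINT x|P. exp (- (complex_of_real x * z)) * h x) holomorphic_on {z. Re z > 0}"
    using sets_half_line_id[OF P(2)] P(3) by (intro laplace_integral_holomorphic) auto
  then show ?thesis by (rule holomorphic_transform) (simp add: P(4))
qed

text \<open>The positive reals accumulate at the interior point \<open>1\<close>, and the half-plane
  is connected.\<close>

lemma holomorphic_eq_right_half_plane:
  assumes "f holomorphic_on {z. Re z > 0}" "g holomorphic_on {z. Re z > 0}"
    and eq: "\<And>x. 0 < x \<Longrightarrow> f (complex_of_real x) = g (complex_of_real x)" and z: "Re z > 0"
  shows "f z = g z"
proof -
  have "f z - g z = 0"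
  proof (rule analytic_continuation[where f = "\<lambda>z. f z - g z" and S = "{z. Re z > 0}" and \<xi> = 1
      and U = "complex_of_real ` {0<..}"])
    show "connected {z. 0 < Re z}" by (intro convex_connected convex_halfspace_Re_gt)
    show "1 islimpt complex_of_real ` {0<..}"
      unfolding islimpt_approachable
    proof (intro allI impI)
      fix e :: real assume "e > 0"
      then have "complex_of_real (1 + e / 2) \<in> complex_of_real ` {0<..}" by (intro imageI) simp
      moreover have "complex_of_real (1 + e / 2) \<noteq> 1" "dist (complex_of_real (1 + e / 2)) 1 < e"
        using \<open>e > 0\<close> by (simp_all add: dist_norm)
      ultimately show "\<exists>x'\<in>complex_of_real ` {0<..}. x' \<noteq> 1 \<and> dist x' 1 < e" by blast
    qed
  qed (use assms in \<open>auto intro!: holomorphic_intros open_halfspace_Re_gt\<close>)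
  then show ?thesis by simp
qed

section \<open>Mixtures of Laplace integrals\<close>

text \<open>Since the inner integrals of the modulus are controlled by an integrable
  \<open>B\<close>, the function \<open>H\<close> is integrable on the product space, and a single
  Laplace integral there represents the mixture. Values are recorded on positive reals only, which
  suffices by analyticity.\<close>

lemma A1_plus_mixture:
  fixes H :: "'b \<times> 'a \<Rightarrow> complex"
  assumes P: "sigma_finite_measure P" and N: "sigma_finite_measure N"
    and \<tau>: "\<tau> \<in> borel_measurable (N \<Otimes>\<^sub>M P)" and pos: "\<And>s x. s \<in> space N \<Longrightarrow> x \<in> space P \<Longrightarrow> 0 \<le> \<tau> (s, x)"
    and H: "H \<in> borel_measurable (N \<Otimes>\<^sub>M P)"
    and int: "\<And>s. s \<in> space N \<Longrightarrow> integrable P (\<lambda>x. H (s, x))"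
    and bound: "\<And>s. s \<in> space N \<Longrightarrow> (LINT x|P. norm (H (s, x))) \<le> B s"
    and B: "integrable N B"
    and G: "\<And>s y. s \<in> space N \<Longrightarrow> 0 < y \<Longrightarrow>
      (LINT x|P. exp (- (complex_of_real (\<tau> (s, x)) * complex_of_real y)) * H (s, x)) = G s y"
  obtains K where "K \<in> A1_plus" "A1_norm K \<le> (LINT s|N. B s)"
    "\<And>y. 0 < y \<Longrightarrow> K (complex_of_real y) = (LINT s|N. G s y)"
proof -
  interpret PP: sigma_finite_measure P by fact
  interpret NN: sigma_finite_measure N by fact
  interpret pair_sigma_finite N P ..
  have nm: "(\<lambda>s. LINT x|P. norm (H (s, x))) \<in> borel_measurable N"
    using PP.borel_measurable_lebesgue_integral[of "\<lambda>s x. norm (H (s, x))" N] H by (simp add: split_beta')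
  have i1: "integrable N (\<lambda>s. LINT x|P. norm (H (s, x)))"
  proof (rule Bochner_Integration.integrable_bound[OF B nm])
    show "AE s in N. norm (LINT x|P. norm (H (s, x))) \<le> norm (B s)"
    proof (rule AE_I2)
      fix s assume "s \<in> space N"
      then show "norm (LINT x|P. norm (H (s, x))) \<le> norm (B s)"
        using bound[of s] by (simp add: integral_nonneg)
    qed
  qed
  have i2: "integrable (N \<Otimes>\<^sub>M P) H"
    by (rule Fubini_integrable[OF H i1]) (use int in auto)
  have pos': "0 \<le> \<tau> w" if "w \<in> space (N \<Otimes>\<^sub>M P)" for w
    using that pos by (cases w) (auto simp: space_pair_measure)
  define K where "K z = (LINT w|(N \<Otimes>\<^sub>M P). exp (- (complex_of_real (\<tau> w) * z)) * H w)" for z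
  show thesis
  proof (rule that[of K])
    show "K \<in> A1_plus" by (rule A1_plusI(1)[OF \<tau> pos' i2 K_def])
    have "A1_norm K \<le> (LINT w|(N \<Otimes>\<^sub>M P). norm (H w))" by (rule A1_plusI(2)[OF \<tau> pos' i2 K_def])
    also have "\<dots> = (LINT s|N. LINT x|P. norm (H (s, x)))"
      by (rule integral_fst'[OF integrable_norm[OF i2], symmetric])
    also have "\<dots> \<le> (LINT s|N. B s)" by (rule integral_mono[OF i1 B bound])
    finally show "A1_norm K \<le> (LINT s|N. B s)" .
    fix y :: real assume y: "0 < y"
    have "integrable (N \<Otimes>\<^sub>M P) (\<lambda>w. exp (- (complex_of_real (\<tau> w) * complex_of_real y)) * H w)"
      using y by (intro integrable_laplace[OF \<tau> pos' i2]) auto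
    then have "K (complex_of_real y) =
        (LINT s|N. LINT x|P. exp (- (complex_of_real (\<tau> (s, x)) * complex_of_real y)) * H (s, x))"
      unfolding K_def by (rule integral_fst'[symmetric])
    also have "\<dots> = (LINT s|N. G s y)"
      by (rule Bochner_Integration.integral_cong[OF refl]) (rule G[OF _ y])
    finally show "K (complex_of_real y) = (LINT s|N. G s y)" .
  qed
qed

lemma integral_pair_mult:
  fixes f :: "'a \<Rightarrow> 'c::{real_normed_field, banach, second_countable_topology}"
  assumes P: "sigma_finite_measure P" and Q: "sigma_finite_measure Q"
    and f: "integrable P f" and g: "integrable Q g"
  shows "integrable (P \<Otimes>\<^sub>M Q) (\<lambda>w. f (fst w) * g (snd w))"
    "(LINT w|(P \<Otimes>\<^sub>M Q). f (fst w) * g (snd w)) = (LINT x|P. f x) * (LINT x|Q. g x)"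
proof -
  interpret P: sigma_finite_measure P by fact
  interpret Q: sigma_finite_measure Q by fact
  interpret pair_sigma_finite P Q ..
  have [measurable]: "f \<in> borel_measurable P" "g \<in> borel_measurable Q" using f g by auto
  have m: "(\<lambda>w. f (fst w) * g (snd w)) \<in> borel_measurable (P \<Otimes>\<^sub>M Q)" by measurable
  show i: "integrable (P \<Otimes>\<^sub>M Q) (\<lambda>w. f (fst w) * g (snd w))"
    by (rule Fubini_integrable[OF m]) (use f g in \<open>simp_all add: norm_mult\<close>)
  show "(LINT w|(P \<Otimes>\<^sub>M Q). f (fst w) * g (snd w)) = (LINT x|P. f x) * (LINT x|Q. g x)"
    by (subst integral_fst'[OF i, symmetric]) simp
qed

section \<open>The kernel of a negative power\<close>

text \<open>For \<open>s > 0\<close> and \<open>\<beta> > 0\<close> this is the Gamma density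
  without its normalising factor \<open>s powr \<beta>\<close>. Extension by \<open>0\<close> to
  negative \<open>u\<close> allows Lebesgue measure on the whole line.\<close>

definition gamma_kernel :: "real \<Rightarrow> real \<Rightarrow> real \<Rightarrow> real" where
  "gamma_kernel \<beta> s u = indicator {0..} u * u powr (\<beta> - 1) * exp (- (s * u)) / Gamma \<beta>"

lemma gamma_kernel_measurable [measurable]:
  "(\<lambda>w. gamma_kernel \<beta> (fst w) (snd w)) \<in> borel_measurable (borel \<Otimes>\<^sub>M borel)"
  unfolding gamma_kernel_def by measurable

lemma gamma_kernel_nonneg: "\<beta> > 0 \<Longrightarrow> 0 \<le> gamma_kernel \<beta> s u"
  by (auto simp: gamma_kernel_def indicator_def intro!: divide_nonneg_pos Gamma_real_pos)

text \<open>An exponential factor shifts the rate, so the Laplace transform of the kernel at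
  \<open>x\<close> is the mass of the kernel with rate \<open>x + s\<close>. The modulus makes the
  exponent nonnegative on the whole line, as \<open>A1_plusI\<close> requires; the kernel vanishes
  where \<open>\<bar>u\<bar>\<close> and \<open>u\<close> differ.\<close>

lemma gamma_kernel_shift: "exp (- (\<bar>u\<bar> * x)) * gamma_kernel \<beta> s u = gamma_kernel \<beta> (x + s) u"
  by (auto simp: gamma_kernel_def indicator_def exp_add[symmetric] algebra_simps)

text \<open>Scaling the variable by \<open>y\<close> in Euler's integral for
  \<open>Gamma \<beta>\<close>.\<close>

lemma has_bochner_integral_gamma_kernel:
  assumes \<beta>: "\<beta> > 0" and y: "y > 0"
  shows "has_bochner_integral lborel (gamma_kernel \<beta> y) (y powr (- \<beta>))"
proof (rule has_bochner_integral_nn_integral)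
  have m[measurable]: "gamma_kernel \<beta> y \<in> borel_measurable borel"
    unfolding gamma_kernel_def by measurable
  then show "gamma_kernel \<beta> y \<in> borel_measurable lborel" by simp
  show "AE u in lborel. 0 \<le> gamma_kernel \<beta> y u" using gamma_kernel_nonneg[OF \<beta>] by simp
  show "0 \<le> y powr - \<beta>" by simp
  have Gp: "Gamma \<beta> > 0" using \<beta> by (rule Gamma_real_pos)
  let ?g = "\<lambda>t. ennreal (indicator {0..} t * t powr (\<beta> - 1) / exp t)"
  have "ennreal (Gamma \<beta>) = (\<integral>\<^sup>+t. ?g t \<partial>lborel)"
    by (rule Gamma_conv_nn_integral_real[OF \<beta>])
  also have "\<dots> = ennreal \<bar>y\<bar> * (\<integral>\<^sup>+t. ?g (0 + y * t) \<partial>lborel)"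
    using y by (intro nn_integral_real_affine) auto
  also have "(\<integral>\<^sup>+t. ?g (0 + y * t) \<partial>lborel) =
      (\<integral>\<^sup>+t. ennreal (Gamma \<beta> * y powr (\<beta> - 1)) * ennreal (gamma_kernel \<beta> y t) \<partial>lborel)"
  proof (rule nn_integral_cong)
    fix t :: real
    have "indicator {0..} (y * t) = (indicator {0..} t :: real)"
      using y by (auto simp: indicator_def zero_le_mult_iff)
    then have "indicator {0..} (0 + y * t) * (0 + y * t) powr (\<beta> - 1) / exp (0 + y * t) =
        Gamma \<beta> * y powr (\<beta> - 1) * gamma_kernel \<beta> y t"
      using y Gp by (auto simp: gamma_kernel_def powr_mult exp_minus field_simps split: split_indicator)
    then show "?g (0 + y * t) = ennreal (Gamma \<beta> * y powr (\<beta> - 1)) * ennreal (gamma_kernel \<beta> y t)"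
      using Gp by (simp add: ennreal_mult'[symmetric])
  qed
  also have "\<dots> = ennreal (Gamma \<beta> * y powr (\<beta> - 1)) * (\<integral>\<^sup>+t. ennreal (gamma_kernel \<beta> y t) \<partial>lborel)"
    by (rule nn_integral_cmult) measurable
  also have "ennreal \<bar>y\<bar> * \<dots> = ennreal (Gamma \<beta> * y powr \<beta>) * (\<integral>\<^sup>+t. ennreal (gamma_kernel \<beta> y t) \<partial>lborel)"
  proof -
    have "\<bar>y\<bar> * (Gamma \<beta> * y powr (\<beta> - 1)) = Gamma \<beta> * y powr \<beta>"
      using y by (simp add: powr_diff)
    moreover have "ennreal \<bar>y\<bar> * ennreal (Gamma \<beta> * y powr (\<beta> - 1)) = ennreal (\<bar>y\<bar> * (Gamma \<beta> * y powr (\<beta> - 1)))"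
      by (rule ennreal_mult'[symmetric]) simp
    ultimately show ?thesis by (simp only: mult.assoc[symmetric])
  qed
  finally have *: "ennreal (Gamma \<beta>) = ennreal (Gamma \<beta> * y powr \<beta>) * (\<integral>\<^sup>+t. ennreal (gamma_kernel \<beta> y t) \<partial>lborel)" .
  have "ennreal (y powr (- \<beta>)) = ennreal (y powr (- \<beta>) / Gamma \<beta>) * ennreal (Gamma \<beta>)"
    using Gp by (simp add: ennreal_mult'[symmetric])
  also have "\<dots> = ennreal (y powr (- \<beta>) / Gamma \<beta>) * ennreal (Gamma \<beta> * y powr \<beta>) * (\<integral>\<^sup>+t. ennreal (gamma_kernel \<beta> y t) \<partial>lborel)"
    by (subst *) (simp add: mult.assoc)
  also have "ennreal (y powr (- \<beta>) / Gamma \<beta>) * ennreal (Gamma \<beta> * y powr \<beta>) = 1"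
    using Gp y by (simp add: ennreal_mult'[symmetric] powr_minus)
  finally show "(\<integral>\<^sup>+u. ennreal (gamma_kernel \<beta> y u) \<partial>lborel) = ennreal (y powr (- \<beta>))" by simp
qed

section \<open>The function \<open>(z / (z + 1)) powr \<beta>\<close>\<close>

text \<open>The terms telescope: \<open>d n - d (Suc n)\<close> is \<open>\<beta>\<close> times the
  term with index \<open>n + N\<close>, and \<open>d\<close> is decreasing and nonnegative. The
  shift by \<open>N \<ge> \<beta>\<close> fixes the sign of \<open>\<beta> - m\<close> for all
  indices \<open>m \<ge> N\<close>. Absolute summability, that is, convergence on the boundary of
  the disc, is needed because the kernels representing the powers of \<open>1 / (z + 1)\<close> all
  have mass \<open>1\<close>.\<close>

lemma summable_abs_gbinomial:
  fixes \<beta> :: real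
  assumes "\<beta> > 0"
  shows "summable (\<lambda>n. \<bar>\<beta> gchoose n\<bar>)"
proof -
  let ?c = "\<lambda>n. \<bar>\<beta> gchoose n\<bar>"
  obtain N :: nat where N: "\<beta> \<le> real N" using real_arch_simple by blast
  define d where "d n = real (n + N) * ?c (n + N)" for n
  have step: "d n - d (Suc n) = \<beta> * ?c (n + N)" for n
  proof -
    let ?m = "n + N"
    have "real (Suc ?m) * (\<beta> gchoose Suc ?m) = (\<beta> - real ?m) * (\<beta> gchoose ?m)"
      using gbinomial_mult_1[of \<beta> ?m] by (simp add: algebra_simps)
    then have "\<bar>real (Suc ?m) * (\<beta> gchoose Suc ?m)\<bar> = \<bar>\<beta> - real ?m\<bar> * ?c ?m" by (simp only: abs_mult)
    moreover have "\<bar>\<beta> - real ?m\<bar> = real ?m - \<beta>" using N by simp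
    ultimately have "real (Suc ?m) * ?c (Suc ?m) = (real ?m - \<beta>) * ?c ?m"
      by (simp only: abs_mult abs_of_nat)
    then show ?thesis by (simp add: d_def algebra_simps)
  qed
  have "decseq d"
  proof (rule decseq_SucI)
    fix n
    have "0 \<le> \<beta> * ?c (n + N)" using assms by simp
    then show "d (Suc n) \<le> d n" using step[of n] by linarith
  qed
  then obtain L where "d \<longlonglongrightarrow> L"
    by (rule decseq_convergent[of d 0]) (simp_all add: d_def)
  then have "summable (\<lambda>n. \<beta> * ?c (n + N))"
    unfolding step[symmetric] by (rule telescope_summable')
  then have "summable (\<lambda>n. ?c (n + N))" using assms by simp
  then show ?thesis by (rule summable_iff_shift[THEN iffD1])
qed

text \<open>This keeps the principal power away from its branch cut, so that it is holomorphic on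
  the half-plane.\<close>

lemma right_half_plane_quotient:
  assumes "Re z > 0"
  shows "z / (z + 1) \<notin> \<real>\<^sub>\<le>\<^sub>0" "z + 1 \<noteq> 0"
proof -
  show nz: "z + 1 \<noteq> 0" using assms by (auto simp: complex_eq_iff)
  show "z / (z + 1) \<notin> \<real>\<^sub>\<le>\<^sub>0"
  proof
    assume "z / (z + 1) \<in> \<real>\<^sub>\<le>\<^sub>0"
    then obtain r where r: "r \<le> 0" "z / (z + 1) = complex_of_real r"
      by (auto elim: nonpos_Reals_cases)
    then have "z = complex_of_real r * (z + 1)" using nz by (simp add: field_simps)
    from arg_cong[OF this, of Re] have "Re z = r * (Re z + 1)" by simp
    moreover have "r * (Re z + 1) \<le> 0" using r assms by (intro mult_nonpos_nonneg) auto
    ultimately show False using assms by simp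
  qed
qed

text \<open>The binomial series of \<open>(1 - 1 / (z + 1)) powr \<beta>\<close> is a mixture over a
  counting measure: the power of \<open>1 / (z + 1)\<close> with exponent \<open>Suc n\<close> is
  the Laplace transform of the kernel of order \<open>Suc n\<close> and rate \<open>1\<close>, and
  the coefficients are absolutely summable. The sum is identified on positive reals, where
  \<open>1 / (x + 1) < 1\<close>.\<close>

lemma quotient_powr_A1_plus:
  assumes \<beta>: "\<beta> > 0"
  shows "(\<lambda>z. (z / (z + 1)) powr complex_of_real \<beta>) \<in> A1_plus"
proof -
  \<comment> \<open>The mixture starts at exponent \<open>1\<close>. The constant term comes from a
    point mass at the origin instead of a kernel of positive order, and is added afterwards as
    \<open>K z + 1\<close>.\<close>
  let ?c = "\<lambda>n. (\<beta> gchoose Suc n) * (- 1) ^ Suc n"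
  define H where "H = (\<lambda>(n, u). complex_of_real (?c n * gamma_kernel (real (Suc n)) 1 u))"
  let ?\<tau> = "\<lambda>(n::nat, u). \<bar>u::real\<bar>"
  have gk: "has_bochner_integral lborel (gamma_kernel (real (Suc n)) y) (y powr (- real (Suc n)))"
    if "y > 0" for n y by (rule has_bochner_integral_gamma_kernel) (use that in auto)
  have gm[measurable]: "gamma_kernel b y \<in> borel_measurable borel" for b y
    unfolding gamma_kernel_def by measurable
  have summ: "summable (\<lambda>n. \<bar>?c n\<bar>)"
    using summable_abs_gbinomial[OF \<beta>] by (subst (asm) summable_Suc_iff[symmetric]) (simp add: abs_mult)
  obtain K where K: "K \<in> A1_plus" "A1_norm K \<le> (LINT n|count_space UNIV. \<bar>?c n\<bar>)"
    "\<And>y. 0 < y \<Longrightarrow> K (complex_of_real y) =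
      (LINT n|count_space UNIV. complex_of_real (?c n * (y + 1) powr (- real (Suc n))))"
  proof (rule A1_plus_mixture[where P = lborel and N = "count_space (UNIV :: nat set)" and H = H and \<tau> = ?\<tau>
        and B = "\<lambda>n. \<bar>?c n\<bar>" and G = "\<lambda>n y. complex_of_real (?c n * (y + 1) powr (- real (Suc n)))"])
    show "sigma_finite_measure (count_space (UNIV :: nat set))"
      by (rule sigma_finite_measure_count_space_countable) simp
    show "sigma_finite_measure lborel" by (rule sigma_finite_lborel)
    show "?\<tau> \<in> borel_measurable (count_space UNIV \<Otimes>\<^sub>M lborel)" by measurable
    show "H \<in> borel_measurable (count_space UNIV \<Otimes>\<^sub>M lborel)"
      unfolding H_def by (rule measurable_pair_measure_countable1) simp_all
    show "integrable lborel (\<lambda>u. H (n, u))" for n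
      using gk[of 1 n] by (auto simp: H_def has_bochner_integral_iff)
    show "(LINT u|lborel. norm (H (n, u))) \<le> \<bar>?c n\<bar>" for n
    proof -
      have "(LINT u|lborel. norm (H (n, u))) = (LINT u|lborel. \<bar>?c n\<bar> * gamma_kernel (real (Suc n)) 1 u)"
        unfolding H_def prod.case norm_of_real abs_mult
        by (intro Bochner_Integration.integral_cong refl arg_cong2[where f = "(*)"] abs_of_nonneg gamma_kernel_nonneg) simp
      also have "\<dots> = \<bar>?c n\<bar>"
        using gk[of 1 n] by (simp add: has_bochner_integral_iff)
      finally show ?thesis by simp
    qed
    show "integrable (count_space UNIV) (\<lambda>n. \<bar>?c n\<bar>)"
      using summ by (simp add: integrable_count_space_nat_iff)
    show "(LINT u|lborel. exp (- (complex_of_real (?\<tau> (n, u)) * complex_of_real y)) * H (n, u))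
        = complex_of_real (?c n * (y + 1) powr (- real (Suc n)))" if "y > 0" for n y
    proof -
      have "(LINT u|lborel. exp (- (complex_of_real (?\<tau> (n, u)) * complex_of_real y)) * H (n, u))
        = (LINT u|lborel. complex_of_real (?c n * gamma_kernel (real (Suc n)) (y + 1) u))"
        unfolding H_def prod.case gamma_kernel_shift[symmetric]
        by (intro Bochner_Integration.integral_cong refl)
          (simp only: of_real_mult of_real_minus exp_of_real[symmetric] mult_ac)
      also have "\<dots> = complex_of_real (?c n * (y + 1) powr (- real (Suc n)))"
        unfolding integral_complex_of_real integral_mult_right_zero
        using gk[of "y + 1" n] that by (simp only: has_bochner_integral_iff)
      finally show ?thesis .
    qed
    show "0 \<le> ?\<tau> (n, u)" for n u by simp
  qed (rule that)
  let ?F = "\<lambda>z. (z / (z + 1)) powr complex_of_real \<beta>"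
  have hol: "?F holomorphic_on {z. Re z > 0}"
    using right_half_plane_quotient by (intro holomorphic_intros) auto
  have K1: "(\<lambda>z. K z + 1) \<in> A1_plus" by (rule A1_plus_add(1)[OF K(1) A1_plus_const])
  have "K z + 1 = ?F z" if z: "Re z > 0" for z
  proof (rule holomorphic_eq_right_half_plane[OF A1_plus_holomorphic[OF K1] hol _ z])
    fix x :: real assume x: "0 < x"
    let ?y = "- 1 / (x + 1)"
    have "\<bar>?y\<bar> < 1" using x by (simp add: abs_if)
    then have "(\<lambda>n. (\<beta> gchoose n) * ?y ^ n) sums (1 + ?y) powr \<beta>"
      by (rule gen_binomial_real)
    moreover have "1 + ?y = x / (x + 1)" using x by (simp add: field_simps)
    moreover have "?y ^ n = (- 1) ^ n * (x + 1) powr (- real n)" for n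
    proof -
      have "?y ^ n = (- 1 * inverse (x + 1)) ^ n" by (simp add: divide_inverse)
      also have "\<dots> = (- 1) ^ n * inverse (x + 1) ^ n" by (rule power_mult_distrib)
      also have "inverse (x + 1) ^ n = (x + 1) powr (- real n)"
        using x by (simp add: powr_minus powr_realpow power_inverse)
      finally show ?thesis .
    qed
    ultimately have "(\<lambda>n. (\<beta> gchoose n) * ((- 1) ^ n * (x + 1) powr (- real n))) sums (x / (x + 1)) powr \<beta>"
      by simp
    then have "(\<lambda>n. (\<beta> gchoose Suc n) * ((- 1) ^ Suc n * (x + 1) powr (- real (Suc n)))) sums ((x / (x + 1)) powr \<beta> - 1)"
      using x by (subst sums_Suc_iff[where f = "\<lambda>n. (\<beta> gchoose n) * ((- 1) ^ n * (x + 1) powr (- real n))"]) simp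
    then have "(\<lambda>n. ?c n * (x + 1) powr (- real (Suc n))) sums ((x / (x + 1)) powr \<beta> - 1)"
      by (simp only: mult.assoc)
    then have s: "(\<lambda>n. complex_of_real (?c n * (x + 1) powr (- real (Suc n)))) sums complex_of_real ((x / (x + 1)) powr \<beta> - 1)"
      by (rule sums_of_real)
    have "integrable (count_space UNIV) (\<lambda>n. complex_of_real (?c n * (x + 1) powr (- real (Suc n))))"
      unfolding integrable_count_space_nat_iff
    proof (rule summable_comparison_test'[OF summ, of 0])
      fix n
      have "(x + 1) powr (- real (Suc n)) \<le> 1"
        using x powr_mono2'[of "- real (Suc n)" 1 "x + 1"] by simp
      then have "\<bar>?c n\<bar> * (x + 1) powr (- real (Suc n)) \<le> \<bar>?c n\<bar>" by (intro mult_left_le) auto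
      then show "norm (norm (complex_of_real (?c n * (x + 1) powr (- real (Suc n))))) \<le> \<bar>?c n\<bar>"
        by (simp only: norm_of_real real_norm_def abs_mult abs_abs abs_of_nonneg[OF powr_ge_zero])
    qed
    from sums_unique2[OF sums_integral_count_space_nat[OF this] s]
    have "K (complex_of_real x) = complex_of_real ((x / (x + 1)) powr \<beta> - 1)"
      unfolding K(3)[OF x] .
    moreover have "?F (complex_of_real x) = complex_of_real ((x / (x + 1)) powr \<beta>)"
      using x powr_of_real[of "x / (x + 1)" \<beta>] by simp
    ultimately show "K (complex_of_real x) + 1 = ?F (complex_of_real x)" by simp
  qed
  then show ?thesis using K1 A1_plus_cong(1)[of "\<lambda>z. K z + 1" ?F] by blast
qed

text \<open>The norm dominates all values on the half-plane, and along large integers the values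
  tend to \<open>1\<close>.\<close>

lemma c_const_ge_1:
  assumes "\<beta> > 0"
  shows "c_const \<beta> \<ge> 1"
proof -
  let ?r = "\<lambda>n. real n / real (Suc n)"
  have "(\<lambda>n. ?r n powr \<beta>) \<longlonglongrightarrow> 1 powr \<beta>"
    by (intro tendsto_powr LIMSEQ_n_over_Suc_n tendsto_const) simp
  moreover have "?r n powr \<beta> \<le> c_const \<beta>" if "n \<ge> 1" for n
  proof -
    have "norm ((of_nat n / (of_nat n + 1)) powr complex_of_real \<beta>) \<le> c_const \<beta>"
      unfolding c_const_def using that by (intro A1_norm_bound[OF quotient_powr_A1_plus[OF assms], of "of_nat n"]) simp
    moreover have "(of_nat n / (of_nat n + 1)) powr complex_of_real \<beta> = complex_of_real (?r n powr \<beta>)"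
      using powr_of_real[of "?r n" \<beta>] by (simp add: add.commute)
    ultimately show ?thesis by simp
  qed
  ultimately show ?thesis by (auto intro: LIMSEQ_le_const2)
qed

section \<open>Products with generalized Stieltjes functions\<close>

text \<open>Multiplication corresponds to convolution: for each parameter \<open>s\<close> the
  exponents \<open>x\<close> and \<open>\<sigma> (s, r)\<close> add and the densities multiply on
  the product of the two spaces. Both estimates are instances, one with the Gamma kernel against
  \<open>F\<close>, the other with the dilated quotient against
  \<open>z powr (- \<beta>) * F z\<close>.\<close>

lemma A1_plus_mixture_mult:
  fixes v :: "'s \<times> 'r \<Rightarrow> complex"
  assumes F: "F \<in> A1_plus" and R: "sigma_finite_measure R" and N: "sigma_finite_measure N"
    and \<sigma>[measurable]: "\<sigma> \<in> borel_measurable (N \<Otimes>\<^sub>M R)" and pos: "\<And>s r. s \<in> space N \<Longrightarrow> r \<in> space R \<Longrightarrow> 0 \<le> \<sigma> (s, r)"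
    and v[measurable]: "v \<in> borel_measurable (N \<Otimes>\<^sub>M R)"
    and int: "\<And>s. s \<in> space N \<Longrightarrow> integrable R (\<lambda>r. v (s, r))"
    and bound: "\<And>s. s \<in> space N \<Longrightarrow> (LINT r|R. norm (v (s, r))) \<le> C s"
    and C: "integrable N C"
    and E: "\<And>s y. s \<in> space N \<Longrightarrow> 0 < y \<Longrightarrow>
      (LINT r|R. exp (- (complex_of_real (\<sigma> (s, r)) * complex_of_real y)) * v (s, r)) = complex_of_real (E s y)"
  obtains K where "K \<in> A1_plus" "A1_norm K \<le> A1_norm F * (LINT s|N. C s)"
    "\<And>y. 0 < y \<Longrightarrow> K (complex_of_real y) = F (complex_of_real y) * complex_of_real (LINT s|N. E s y)"
proof -
  obtain P h where P: "finite_measure P" "sets P = sets half_line" "integrable P h"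
    "\<And>z. Re z > 0 \<Longrightarrow> F z = (LINT x|P. exp (- (complex_of_real x * z)) * h x)"
    "A1_norm F = (LINT x|P. norm (h x))"
    by (rule A1_plus_density[OF F]) blast
  note id = sets_half_line_id[OF P(2)]
  interpret PP: finite_measure P by fact
  interpret RR: sigma_finite_measure R by fact
  have sP: "sigma_finite_measure P" by (rule PP.sigma_finite_measure_axioms)
  interpret PR: pair_sigma_finite P R ..
  have sPR: "sigma_finite_measure (P \<Otimes>\<^sub>M R)" by (rule PR.P.sigma_finite_measure_axioms)
  have [measurable]: "h \<in> borel_measurable P" using P(3) by simp
  let ?\<tau> = "\<lambda>w. fst (snd w) + \<sigma> (fst w, snd (snd w))"
  let ?H = "\<lambda>w. h (fst (snd w)) * v (fst w, snd (snd w))"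
  have pm: "(\<lambda>w. fst (snd w)) \<in> borel_measurable (N \<Otimes>\<^sub>M (P \<Otimes>\<^sub>M R))"
    by (rule measurable_compose[OF _ id(2)]) measurable
  have nv: "integrable R (\<lambda>r. norm (v (s, r)))" if "s \<in> space N" for s
    using int[OF that] by (rule integrable_norm)
  obtain K where K: "K \<in> A1_plus" "A1_norm K \<le> (LINT s|N. A1_norm F * C s)"
    "\<And>y. 0 < y \<Longrightarrow> K (complex_of_real y) = (LINT s|N. F (complex_of_real y) * complex_of_real (E s y))"
  proof (rule A1_plus_mixture[OF sPR N, where H = ?H and \<tau> = ?\<tau> and B = "\<lambda>s. A1_norm F * C s"
        and G = "\<lambda>s y. F (complex_of_real y) * complex_of_real (E s y)"])
    show "?\<tau> \<in> borel_measurable (N \<Otimes>\<^sub>M (P \<Otimes>\<^sub>M R))"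
      using pm by (rule borel_measurable_add) measurable
    show "0 \<le> ?\<tau> (s, x)" if "s \<in> space N" "x \<in> space (P \<Otimes>\<^sub>M R)" for s x
    proof -
      have "fst x \<in> {0..}" "snd x \<in> space R" using that(2) unfolding id(1)[symmetric] by (auto simp: space_pair_measure)
      then show ?thesis using pos[OF that(1), of "snd x"] by simp
    qed
    show "?H \<in> borel_measurable (N \<Otimes>\<^sub>M (P \<Otimes>\<^sub>M R))" by measurable
    show "integrable (P \<Otimes>\<^sub>M R) (\<lambda>x. ?H (s, x))" if "s \<in> space N" for s
      using integral_pair_mult(1)[OF sP R P(3) int[OF that]] by simp
    show "(LINT x|(P \<Otimes>\<^sub>M R). norm (?H (s, x))) \<le> A1_norm F * C s" if s: "s \<in> space N" for s
    proof -
      have "(LINT x|(P \<Otimes>\<^sub>M R). norm (?H (s, x))) = (LINT x|P. norm (h x)) * (LINT r|R. norm (v (s, r)))"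
        using integral_pair_mult(2)[OF sP R integrable_norm[OF P(3)] nv[OF s]] by (simp add: norm_mult)
      also have "\<dots> \<le> A1_norm F * C s"
        unfolding P(5) by (intro mult_left_mono bound s) simp
      finally show ?thesis .
    qed
    show "integrable N (\<lambda>s. A1_norm F * C s)" using C by simp
    show "(LINT x|(P \<Otimes>\<^sub>M R). exp (- (complex_of_real (?\<tau> (s, x)) * complex_of_real y)) * ?H (s, x))
        = F (complex_of_real y) * complex_of_real (E s y)" if s: "s \<in> space N" and y: "0 < y" for s y
    proof -
      have "(LINT x|(P \<Otimes>\<^sub>M R). exp (- (complex_of_real (?\<tau> (s, x)) * complex_of_real y)) * ?H (s, x))
        = (LINT x|(P \<Otimes>\<^sub>M R). (exp (- (complex_of_real (fst x) * complex_of_real y)) * h (fst x)) *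
            (exp (- (complex_of_real (\<sigma> (s, snd x)) * complex_of_real y)) * v (s, snd x)))"
      proof (intro Bochner_Integration.integral_cong refl)
        fix x :: "real \<times> 'r"
        let ?e = "\<lambda>p. exp (- (complex_of_real p * complex_of_real y))"
        have "?e (?\<tau> (s, x)) = ?e (fst x) * ?e (\<sigma> (s, snd x))"
          by (simp add: algebra_simps flip: exp_add)
        then show "?e (?\<tau> (s, x)) * ?H (s, x) = (?e (fst x) * h (fst x)) * (?e (\<sigma> (s, snd x)) * v (s, snd x))"
          by (simp only: fst_conv snd_conv mult_ac)
      qed
      also have "\<dots> = (LINT x|P. exp (- (complex_of_real x * complex_of_real y)) * h x) *
         (LINT r|R. exp (- (complex_of_real (\<sigma> (s, r)) * complex_of_real y)) * v (s, r))"
      proof (rule integral_pair_mult(2)[OF sP R])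
        show "integrable P (\<lambda>x. exp (- (complex_of_real x * complex_of_real y)) * h x)"
          by (rule integrable_laplace[OF id(2) _ P(3)]) (use id(1) y in auto)
        have "(\<lambda>r. \<sigma> (s, r)) \<in> borel_measurable R" using s by measurable
        then show "integrable R (\<lambda>r. exp (- (complex_of_real (\<sigma> (s, r)) * complex_of_real y)) * v (s, r))"
          by (rule integrable_laplace[OF _ _ int[OF s]]) (use pos[OF s] y in auto)
      qed
      also have "\<dots> = F (complex_of_real y) * complex_of_real (E s y)"
        unfolding E[OF s y] using P(4)[of "complex_of_real y"] y by simp
      finally show ?thesis .
    qed
  qed (rule that)
  show thesis
  proof (rule that[OF K(1)])
    show "A1_norm K \<le> A1_norm F * (LINT s|N. C s)" using K(2) by simp
    show "K (complex_of_real y) = F (complex_of_real y) * complex_of_real (LINT s|N. E s y)" if "0 < y" for y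
      unfolding K(3)[OF that] by simp
  qed
qed

section \<open>The degenerate case and elementary inequalities\<close>

lemma A1_norm_eq_0:
  assumes "F \<in> A1_plus"
  shows "A1_norm F = 0 \<longleftrightarrow> (\<forall>z. Re z > 0 \<longrightarrow> F z = 0)"
proof
  assume "A1_norm F = 0"
  then show "\<forall>z. Re z > 0 \<longrightarrow> F z = 0" using A1_norm_bound[OF assms] by auto
next
  assume "\<forall>z. Re z > 0 \<longrightarrow> F z = 0"
  then have "A1_norm F = A1_norm (\<lambda>z. 0 * F z)" by (intro A1_plus_cong(2)) simp
  also have "\<dots> \<le> norm (0::complex) * A1_norm F" by (rule A1_plus_cmult(2)[OF assms])
  finally show "A1_norm F = 0" using A1_norm_nonneg[OF assms] by simp
qed

text \<open>Both \<open>1 / (x + s) \<le> 1 / x\<close> and \<open>s / (x + s) \<le> 1\<close>. The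
  weighted Stieltjes kernel is therefore bounded in \<open>s\<close>, hence integrable against any
  finite measure on the positive half-line.\<close>

lemma powr_quotient_bound:
  fixes \<beta> x s :: real
  assumes "\<beta> > 0" "x > 0" "s \<ge> 0"
  shows "(1 + s) powr \<beta> * (x + s) powr (- \<beta>) \<le> (1 + 1 / x) powr \<beta>"
proof -
  have "(1 + s) powr \<beta> * (x + s) powr (- \<beta>) = ((1 + s) / (x + s)) powr \<beta>"
    using assms by (simp add: powr_divide powr_minus_divide)
  also have "\<dots> \<le> (1 + 1 / x) powr \<beta>"
    using assms by (intro powr_mono2) (auto simp: field_simps)
  finally show ?thesis .
qed

text \<open>The maximum of two numbers is at least their mean; this is the origin of the factor
  \<open>2 powr \<beta>\<close>.\<close>

lemma max_powr_bound:
  fixes \<beta> s t :: real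
  assumes "\<beta> > 0" "s > 0" "t > 0"
  shows "max s t powr (- \<beta>) \<le> 2 powr \<beta> * (t + s) powr (- \<beta>)"
proof -
  have "max s t powr (- \<beta>) \<le> ((t + s) / 2) powr (- \<beta>)"
    using assms by (intro powr_mono2') auto
  also have "\<dots> = 2 powr \<beta> * (t + s) powr (- \<beta>)"
    using assms by (simp add: powr_divide powr_minus_divide)
  finally show ?thesis .
qed

text \<open>
  \<open>N\<close> stands for the measure with density \<open>1 / (1 + s) powr \<beta>\<close> with respect to the Stieltjes measure; it is
  finite, so Fubini's theorem applies.
\<close>

lemma A1_plus_stieltjes_integral:
  assumes \<beta>: "\<beta> > 0" and F: "F \<in> A1_plus"
    and Fm: "(\<lambda>z. z powr (- complex_of_real \<beta>) * F z) \<in> A1_plus" (is "?Fm \<in> _")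
    and N: "finite_measure N" "sets N = sets (restrict_space borel {0<..})"
    and t: "t > 0"
    and bal: "A1_norm (\<lambda>z. z powr (- complex_of_real \<beta>) * F z) * c_const \<beta> \<le> A1_norm F * t powr (- \<beta>)"
  obtains K where "K \<in> A1_plus"
    "A1_norm K \<le> 2 powr \<beta> * A1_norm F * (LINT s|N. (1 + s) powr \<beta> * (t + s) powr (- \<beta>))"
    "\<And>x. 0 < x \<Longrightarrow> K (complex_of_real x) =
       F (complex_of_real x) * complex_of_real (LINT s|N. (1 + s) powr \<beta> * (x + s) powr (- \<beta>))"
proof -
  interpret NN: finite_measure N by fact
  have sN: "sigma_finite_measure N" by (rule NN.sigma_finite_measure_axioms)
  have spN: "space N = {0<..}" using sets_eq_imp_space_eq[OF N(2)] by (simp add: space_restrict_space)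
  have meas: "f \<in> borel_measurable N" if "f \<in> borel_measurable borel" for f :: "real \<Rightarrow> real"
    unfolding measurable_cong_sets[OF N(2) refl] using that by (rule measurable_restrict_space1)
  have idN: "(\<lambda>s. s) \<in> borel_measurable N" by (rule meas) simp
  have bint: "integrable N f" if "f \<in> borel_measurable borel" "\<And>s. s > 0 \<Longrightarrow> \<bar>f s\<bar> \<le> B" for f :: "real \<Rightarrow> real" and B
    using that meas[OF that(1)] by (intro NN.integrable_const_bound[of _ B]) (auto simp: spN)
  \<comment> \<open>The factor \<open>(1 + s) powr \<beta>\<close> undoes the density in
    \<open>N\<close>. The weight \<open>W1\<close> carries the range \<open>s \<ge> t\<close> and is
    paired with the kernel bound, \<open>W2\<close> carries \<open>s < t\<close> and is paired with
    the bound that is constant in \<open>s\<close>.\<close>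
  define W1 where "W1 s = (if t \<le> s then (1 + s) powr \<beta> else 0)" for s :: real
  define W2 where "W2 s = (if t \<le> s then 0 else (1 + s) powr \<beta>)" for s :: real
  have [measurable]: "W1 \<in> borel_measurable borel" "W2 \<in> borel_measurable borel"
    unfolding W1_def W2_def by measurable
  have W_nonneg: "W1 s \<ge> 0" "W2 s \<ge> 0" for s by (simp_all add: W1_def W2_def)
  have gm[measurable]: "gamma_kernel \<beta> y \<in> borel_measurable borel" for y
    unfolding gamma_kernel_def by measurable
  have gk: "has_bochner_integral lborel (gamma_kernel \<beta> y) (y powr (- \<beta>))" if "y > 0" for y
    by (rule has_bochner_integral_gamma_kernel[OF \<beta> that])
  have J: "integrable N (\<lambda>s. (1 + s) powr \<beta> * (x + s) powr (- \<beta>))" if "x > 0" for x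
    using powr_quotient_bound[OF \<beta> that] by (intro bint[where B = "(1 + 1 / x) powr \<beta>"]) auto
  have J1: "integrable N (\<lambda>s. W1 s * (x + s) powr (- \<beta>))" and J2: "integrable N (\<lambda>s. W2 s * (x + s) powr (- \<beta>))"
    if "x > 0" for x
    using powr_quotient_bound[OF \<beta> that]
    by (intro bint[where B = "(1 + 1 / x) powr \<beta>"]; force simp: W1_def W2_def)+
  \<comment> \<open>The mass \<open>s powr (- \<beta>)\<close> of the kernel is singular at
    \<open>0\<close>, but \<open>W1\<close> vanishes below \<open>t\<close>; hence a bound in terms
    of \<open>t\<close>.\<close>
  have I1: "integrable N (\<lambda>s. W1 s * s powr (- \<beta>))"
  proof (rule bint)
    fix s :: real assume s: "s > 0"
    show "\<bar>W1 s * s powr (- \<beta>)\<bar> \<le> (1 + 1 / t) powr \<beta>"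
    proof (cases "t \<le> s")
      case True
      have "(1 + s) powr \<beta> * s powr (- \<beta>) = ((1 + s) / s) powr \<beta>"
        using s by (simp add: powr_divide powr_minus_divide)
      also have "\<dots> \<le> (1 + 1 / t) powr \<beta>"
        using s True \<beta> t by (intro powr_mono2) (auto simp: field_simps)
      finally show ?thesis using True by (simp add: W1_def)
    qed (simp add: W1_def)
  qed measurable
  \<comment> \<open>Boundedness of \<open>W2\<close> comes from its support below \<open>t\<close>;
    the factor \<open>(1 + s) powr \<beta>\<close> itself is unbounded.\<close>
  have I2: "integrable N W2"
  proof (rule bint)
    fix s :: real assume s: "s > 0"
    show "\<bar>W2 s\<bar> \<le> (1 + t) powr \<beta>"
      using s \<beta> by (auto simp: W2_def intro!: powr_mono2)
  qed measurable
  \<comment> \<open>The contribution of \<open>s \<ge> t\<close>: the Gamma kernel of rate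
    \<open>s\<close> represents \<open>1 / (z + s) powr \<beta>\<close> and has mass
    \<open>s powr (- \<beta>)\<close>.\<close>
  obtain K1 where K1: "K1 \<in> A1_plus" "A1_norm K1 \<le> A1_norm F * (LINT s|N. W1 s * s powr (- \<beta>))"
    "\<And>y. 0 < y \<Longrightarrow> K1 (complex_of_real y) = F (complex_of_real y) * complex_of_real (LINT s|N. W1 s * (y + s) powr (- \<beta>))"
  proof (rule A1_plus_mixture_mult[OF F sigma_finite_lborel sN, where \<sigma> = "\<lambda>w. \<bar>snd w\<bar>"
        and v = "\<lambda>w. complex_of_real (W1 (fst w) * gamma_kernel \<beta> (fst w) (snd w))"
        and C = "\<lambda>s. W1 s * s powr (- \<beta>)" and E = "\<lambda>s y. W1 s * (y + s) powr (- \<beta>)"])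
    have f: "fst \<in> borel_measurable (N \<Otimes>\<^sub>M lborel)"
      by (rule measurable_compose[OF measurable_fst idN])
    have "(\<lambda>w. (fst w, snd w)) \<in> measurable (N \<Otimes>\<^sub>M lborel) (borel \<Otimes>\<^sub>M borel)"
      using f by (rule measurable_Pair) simp
    then have "(\<lambda>w. gamma_kernel \<beta> (fst (fst w, snd w)) (snd (fst w, snd w))) \<in> borel_measurable (N \<Otimes>\<^sub>M lborel)"
      by (rule measurable_compose[OF _ gamma_kernel_measurable])
    moreover have "(\<lambda>w. W1 (fst w)) \<in> borel_measurable (N \<Otimes>\<^sub>M lborel)"
      using f by (rule measurable_compose) measurable
    ultimately show "(\<lambda>w. complex_of_real (W1 (fst w) * gamma_kernel \<beta> (fst w) (snd w))) \<in> borel_measurable (N \<Otimes>\<^sub>M lborel)"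
      unfolding fst_conv snd_conv by measurable
    show "integrable lborel (\<lambda>r. complex_of_real (W1 (fst (s, r)) * gamma_kernel \<beta> (fst (s, r)) (snd (s, r))))"
      if "s \<in> space N" for s using gk[of s] that by (auto simp: spN has_bochner_integral_iff)
    show "(LINT r|lborel. norm (complex_of_real (W1 (fst (s, r)) * gamma_kernel \<beta> (fst (s, r)) (snd (s, r)))))
        \<le> W1 s * s powr (- \<beta>)" if "s \<in> space N" for s
      using gk[of s] that W_nonneg gamma_kernel_nonneg[OF \<beta>] by (simp add: spN has_bochner_integral_iff norm_mult)
    show "(LINT r|lborel. exp (- (complex_of_real \<bar>snd (s, r)\<bar> * complex_of_real y)) *
          complex_of_real (W1 (fst (s, r)) * gamma_kernel \<beta> (fst (s, r)) (snd (s, r))))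
        = complex_of_real (W1 s * (y + s) powr (- \<beta>))" if "s \<in> space N" "0 < y" for s y
    proof -
      have "(LINT r|lborel. exp (- (complex_of_real \<bar>snd (s, r)\<bar> * complex_of_real y)) *
          complex_of_real (W1 (fst (s, r)) * gamma_kernel \<beta> (fst (s, r)) (snd (s, r))))
        = (LINT r|lborel. complex_of_real (W1 s * gamma_kernel \<beta> (y + s) r))"
        unfolding gamma_kernel_shift[symmetric] fst_conv snd_conv
        by (intro Bochner_Integration.integral_cong refl)
          (simp only: of_real_mult of_real_minus exp_of_real[symmetric] mult_ac)
      also have "\<dots> = complex_of_real (W1 s * (y + s) powr (- \<beta>))"
        unfolding integral_complex_of_real integral_mult_right_zero
        using gk[of "y + s"] that by (simp add: has_bochner_integral_iff spN)
      finally show ?thesis .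
    qed
  qed (use I1 in \<open>auto intro: that\<close>)
  let ?Q = "\<lambda>z. (z / (z + 1)) powr complex_of_real \<beta>"
  obtain R k where R: "finite_measure R" "sets R = sets half_line" "integrable R k"
    "\<And>z. Re z > 0 \<Longrightarrow> ?Q z = (LINT x|R. exp (- (complex_of_real x * z)) * k x)"
    "A1_norm ?Q = (LINT x|R. norm (k x))"
    by (rule A1_plus_density[OF quotient_powr_A1_plus[OF \<beta>]]) blast
  interpret RR: finite_measure R by fact
  have [measurable]: "k \<in> borel_measurable R" using R(3) by simp
  note idR = sets_half_line_id[OF R(2)]
  \<comment> \<open>The contribution of \<open>s < t\<close>: the exponent \<open>r / s\<close>
    dilates the measure of \<open>?Q\<close>, because
    \<open>?Q (y / s) = (y / (y + s)) powr \<beta>\<close>. Dilation leaves the mass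
    \<open>c_const \<beta>\<close> unchanged.\<close>
  obtain K2 where K2: "K2 \<in> A1_plus" "A1_norm K2 \<le> A1_norm ?Fm * (LINT s|N. W2 s * c_const \<beta>)"
    "\<And>y. 0 < y \<Longrightarrow> K2 (complex_of_real y) = ?Fm (complex_of_real y) *
        complex_of_real (LINT s|N. W2 s * (y / (y + s)) powr \<beta>)"
  proof (rule A1_plus_mixture_mult[OF Fm RR.sigma_finite_measure_axioms sN, where \<sigma> = "\<lambda>w. snd w / fst w"
        and v = "\<lambda>w. complex_of_real (W2 (fst w)) * k (snd w)"
        and C = "\<lambda>s. W2 s * c_const \<beta>" and E = "\<lambda>s y. W2 s * (y / (y + s)) powr \<beta>"])
    have f: "fst \<in> borel_measurable (N \<Otimes>\<^sub>M R)"
      by (rule measurable_compose[OF measurable_fst idN])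
    have r: "snd \<in> borel_measurable (N \<Otimes>\<^sub>M R)"
      by (rule measurable_compose[OF measurable_snd idR(2)])
    show "(\<lambda>w. snd w / fst w) \<in> borel_measurable (N \<Otimes>\<^sub>M R)"
      using r f by (rule borel_measurable_divide)
    have "(\<lambda>w. W2 (fst w)) \<in> borel_measurable (N \<Otimes>\<^sub>M R)"
      using f by (rule measurable_compose) measurable
    then show "(\<lambda>w. complex_of_real (W2 (fst w)) * k (snd w)) \<in> borel_measurable (N \<Otimes>\<^sub>M R)"
      by measurable
    show "0 \<le> snd (s, r) / fst (s, r)" if "s \<in> space N" "r \<in> space R" for s r
      using that by (simp add: spN idR(1))
    show "integrable R (\<lambda>r. complex_of_real (W2 (fst (s, r))) * k (snd (s, r)))" for s
      using R(3) by simp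
    show "(LINT r|R. norm (complex_of_real (W2 (fst (s, r))) * k (snd (s, r)))) \<le> W2 s * c_const \<beta>" for s
      using W_nonneg by (simp add: norm_mult c_const_def R(5))
    show "integrable N (\<lambda>s. W2 s * c_const \<beta>)" using I2 by simp
    show "(LINT r|R. exp (- (complex_of_real (snd (s, r) / fst (s, r)) * complex_of_real y)) *
          (complex_of_real (W2 (fst (s, r))) * k (snd (s, r))))
        = complex_of_real (W2 s * (y / (y + s)) powr \<beta>)" if s: "s \<in> space N" and y: "0 < y" for s y
    proof -
      have s0: "s > 0" using s by (simp add: spN)
      have "(LINT r|R. exp (- (complex_of_real (snd (s, r) / fst (s, r)) * complex_of_real y)) *
          (complex_of_real (W2 (fst (s, r))) * k (snd (s, r))))
        = complex_of_real (W2 s) * (LINT r|R. exp (- (complex_of_real r * complex_of_real (y / s))) * k r)"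
        unfolding integral_mult_right_zero[symmetric] fst_conv snd_conv
        by (intro Bochner_Integration.integral_cong refl) (simp add: mult_ac)
      also have "\<dots> = complex_of_real (W2 s) * ?Q (complex_of_real (y / s))"
        using R(4)[of "complex_of_real (y / s)"] s0 y by simp
      also have "?Q (complex_of_real (y / s)) = complex_of_real ((y / s / (y / s + 1)) powr \<beta>)"
        using s0 y powr_of_real[of "y / s / (y / s + 1)" \<beta>] by simp
      also have "y / s / (y / s + 1) = y / (y + s)" using s0 y by (simp add: field_simps)
      finally show ?thesis by simp
    qed
  qed (rule that)
  show thesis
  proof (rule that)
    show "(\<lambda>z. K1 z + K2 z) \<in> A1_plus" by (rule A1_plus_add(1)[OF K1(1) K2(1)])
    have "A1_norm (\<lambda>z. K1 z + K2 z) \<le> A1_norm K1 + A1_norm K2" by (rule A1_plus_add(2)[OF K1(1) K2(1)])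
    also have "\<dots> \<le> A1_norm F * (LINT s|N. W1 s * s powr (- \<beta>)) + (A1_norm F * t powr (- \<beta>)) * (LINT s|N. W2 s)"
    proof -
      have "A1_norm ?Fm * (LINT s|N. W2 s * c_const \<beta>) = (A1_norm ?Fm * c_const \<beta>) * (LINT s|N. W2 s)"
        by simp
      \<comment> \<open>By \<open>bal\<close> the constant bound becomes
        \<open>A1_norm F * t powr (- \<beta>)\<close>, the value of the kernel bound at
        \<open>s = t\<close>.\<close>
      also have "\<dots> \<le> (A1_norm F * t powr (- \<beta>)) * (LINT s|N. W2 s)"
        using W_nonneg by (intro mult_right_mono bal integral_nonneg) auto
      finally show ?thesis using K1(2) K2(2) by linarith
    qed
    also have "\<dots> = A1_norm F * (LINT s|N. W1 s * s powr (- \<beta>) + W2 s * t powr (- \<beta>))"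
      using I1 I2 by (simp add: algebra_simps)
    also have "\<dots> \<le> A1_norm F * (LINT s|N. 2 powr \<beta> * ((1 + s) powr \<beta> * (t + s) powr (- \<beta>)))"
    proof (intro mult_left_mono integral_mono A1_norm_nonneg[OF F])
      fix s assume "s \<in> space N"
      then have s: "s > 0" by (simp add: spN)
      \<comment> \<open>The two weights have complementary ranges, and on each of them the surviving
        power is that of the larger of \<open>s\<close> and \<open>t\<close>.\<close>
      have "W1 s * s powr (- \<beta>) + W2 s * t powr (- \<beta>) = (1 + s) powr \<beta> * max s t powr (- \<beta>)"
        by (simp add: W1_def W2_def max_def)
      also have "\<dots> \<le> (1 + s) powr \<beta> * (2 powr \<beta> * (t + s) powr (- \<beta>))"
        by (intro mult_left_mono max_powr_bound[OF \<beta> s t]) simp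
      finally show "W1 s * s powr (- \<beta>) + W2 s * t powr (- \<beta>) \<le> 2 powr \<beta> * ((1 + s) powr \<beta> * (t + s) powr (- \<beta>))"
        by (simp add: mult_ac)
    qed (use I1 I2 J[OF t] in auto)
    also have "\<dots> = 2 powr \<beta> * A1_norm F * (LINT s|N. (1 + s) powr \<beta> * (t + s) powr (- \<beta>))"
      by simp
    finally show "A1_norm (\<lambda>z. K1 z + K2 z) \<le> 2 powr \<beta> * A1_norm F * (LINT s|N. (1 + s) powr \<beta> * (t + s) powr (- \<beta>))" .
    fix x :: real assume x: "0 < x"
    have e1: "?Fm (complex_of_real x) = complex_of_real (x powr (- \<beta>)) * F (complex_of_real x)"
      using x powr_of_real[of x "- \<beta>"] by simp
    \<comment> \<open>The numerator leaves the integral as \<open>x powr \<beta>\<close> and cancels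
      against the factor \<open>x powr (- \<beta>)\<close> in \<open>?Fm\<close>.\<close>
    have e2: "(LINT s|N. W2 s * (x / (x + s)) powr \<beta>) = x powr \<beta> * (LINT s|N. W2 s * (x + s) powr (- \<beta>))"
      unfolding integral_mult_right_zero[symmetric] using x
      by (intro Bochner_Integration.integral_cong refl) (simp add: spN powr_divide powr_minus_divide)
    have "K2 (complex_of_real x) = F (complex_of_real x) * complex_of_real (x powr (- \<beta>) * x powr \<beta> * (LINT s|N. W2 s * (x + s) powr (- \<beta>)))"
      unfolding K2(3)[OF x] e1 e2 by (simp only: of_real_mult mult_ac)
    also have "x powr (- \<beta>) * x powr \<beta> = 1" using x by (simp add: powr_minus)
    finally have "K1 (complex_of_real x) + K2 (complex_of_real x) = F (complex_of_real x) *
        complex_of_real ((LINT s|N. W1 s * (x + s) powr (- \<beta>)) + (LINT s|N. W2 s * (x + s) powr (- \<beta>)))"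
      unfolding K1(3)[OF x] by (simp add: algebra_simps)
    also have "(LINT s|N. W1 s * (x + s) powr (- \<beta>)) + (LINT s|N. W2 s * (x + s) powr (- \<beta>))
       = (LINT s|N. W1 s * (x + s) powr (- \<beta>) + W2 s * (x + s) powr (- \<beta>))"
      by (rule Bochner_Integration.integral_add[symmetric, OF J1[OF x] J2[OF x]])
    also have "\<dots> = (LINT s|N. (1 + s) powr \<beta> * (x + s) powr (- \<beta>))"
      by (intro Bochner_Integration.integral_cong refl) (simp add: W1_def W2_def)
    finally show "K1 (complex_of_real x) + K2 (complex_of_real x) =
       F (complex_of_real x) * complex_of_real (LINT s|N. (1 + s) powr \<beta> * (x + s) powr (- \<beta>))" .
  qed
qed

text \<open>The integrability condition says exactly that the density
  \<open>1 / (1 + s) powr \<beta>\<close> produces a finite measure; the factor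
  \<open>(1 + s) powr \<beta>\<close> in the integrand compensates for it.\<close>

lemma gen_stieltjes_finite_measure:
  assumes "f \<in> gen_stieltjes \<beta>"
  obtains a0 b0 N where "0 \<le> a0" "0 \<le> b0" "finite_measure N" "sets N = sets (restrict_space borel {0<..})"
    "\<And>x. 0 < x \<Longrightarrow> f x = a0 * x powr (- \<beta>) + b0 + (LINT s|N. (1 + s) powr \<beta> * (x + s) powr (- \<beta>))"
proof -
  obtain a0 b0 \<nu> where s: "a0 \<ge> 0" "b0 \<ge> 0" "sets \<nu> = sets (restrict_space borel {0<..})"
    and fin: "(\<integral>\<^sup>+ s. ennreal (1 / (1 + s) powr \<beta>) \<partial>\<nu>) < \<infinity>"
    and f: "\<And>x. x > 0 \<Longrightarrow> f x = a0 / x powr \<beta> + b0 + (LINT s|\<nu>. 1 / (x + s) powr \<beta>)"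
    using assms unfolding gen_stieltjes_def radon_measure_pos_def by blast
  have sp: "space \<nu> = {0<..}" using sets_eq_imp_space_eq[OF s(3)] by (simp add: space_restrict_space)
  have meas: "f \<in> borel_measurable \<nu>" if "f \<in> borel_measurable borel" for f :: "real \<Rightarrow> real"
    unfolding measurable_cong_sets[OF s(3) refl] using that by (rule measurable_restrict_space1)
  have m1: "(\<lambda>s. 1 / (1 + s) powr \<beta>) \<in> borel_measurable \<nu>" by (rule meas) measurable
  define N where "N = density \<nu> (\<lambda>s. ennreal (1 / (1 + s) powr \<beta>))"
  have "emeasure N (space N) = (\<integral>\<^sup>+ s. ennreal (1 / (1 + s) powr \<beta>) * indicator (space \<nu>) s \<partial>\<nu>)"
    unfolding N_def space_density by (rule emeasure_density) (use m1 in auto)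
  also have "\<dots> = (\<integral>\<^sup>+ s. ennreal (1 / (1 + s) powr \<beta>) \<partial>\<nu>)"
    by (rule nn_integral_cong) simp
  finally have "finite_measure N" using fin by (intro finite_measureI) simp
  moreover have "f x = a0 * x powr (- \<beta>) + b0 + (LINT s|N. (1 + s) powr \<beta> * (x + s) powr (- \<beta>))" if "0 < x" for x
  proof -
    have m2: "(\<lambda>s. (1 + s) powr \<beta> * (x + s) powr (- \<beta>)) \<in> borel_measurable \<nu>" by (rule meas) measurable
    have "(LINT s|N. (1 + s) powr \<beta> * (x + s) powr (- \<beta>)) =
        (LINT s|\<nu>. (1 / (1 + s) powr \<beta>) *\<^sub>R ((1 + s) powr \<beta> * (x + s) powr (- \<beta>)))"
      unfolding N_def by (rule integral_density[OF m2 m1]) simp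
    also have "\<dots> = (LINT s|\<nu>. 1 / (x + s) powr \<beta>)"
      by (intro Bochner_Integration.integral_cong refl) (simp add: sp powr_minus divide_inverse)
    finally show ?thesis using f[OF that] by (simp add: powr_minus divide_inverse)
  qed
  ultimately show thesis using that[of a0 b0 N] s by (simp add: N_def)
qed

theorem theorem4p2:
  fixes F g :: "complex \<Rightarrow> complex" and f :: "real \<Rightarrow> real" and a b \<beta> :: real
  assumes "\<beta> > 0"
    and "F \<in> A1_plus"
    and "(\<lambda>z. z powr (- complex_of_real \<beta>) * F z) \<in> A1_plus"
    and "A1_norm F = a"
    and "A1_norm (\<lambda>z. z powr (- complex_of_real \<beta>) * F z) = b"
    and "f \<in> gen_stieltjes \<beta>"
    and "analytic_extension f g"
  shows "(\<lambda>z. F z * g z) \<in> A1_plus \<and>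
    A1_norm (\<lambda>z. F z * g z)
      \<le> 2 powr \<beta> * a * f ((a / b) powr (1 / \<beta>) * c_const \<beta> powr (- 1 / \<beta>))"
proof (cases "a = 0")
  \<comment> \<open>Here the argument of \<open>f\<close> is \<open>0\<close>, where nothing is
    known about \<open>f\<close>. The factor \<open>a\<close> makes the right-hand side vanish, and
    \<open>F\<close> is zero on the half-plane.\<close>
  case True
  have "F z = 0" if "Re z > 0" for z
    using A1_norm_eq_0[OF assms(2)] assms(4) True that by simp
  then have eq: "F z * g z = 0 * F z" if "Re z > 0" for z using that by simp
  have "A1_norm (\<lambda>z. F z * g z) = A1_norm (\<lambda>z. 0 * F z)"
    by (rule A1_plus_cong(2)) (rule eq)
  moreover have "A1_norm (\<lambda>z. 0 * F z) \<le> norm (0 :: complex) * A1_norm F"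
    by (rule A1_plus_cmult(2)[OF assms(2)])
  moreover have "(\<lambda>z. F z * g z) \<in> A1_plus \<longleftrightarrow> (\<lambda>z. 0 * F z) \<in> A1_plus"
    by (rule A1_plus_cong(1)) (rule eq)
  moreover have "(\<lambda>z. 0 * F z) \<in> A1_plus"
    by (rule A1_plus_cmult(1)[OF assms(2)])
  ultimately show ?thesis using True by simp
next
  case False
  let ?Fm = "\<lambda>z. z powr (- complex_of_real \<beta>) * F z"
  note \<beta> = assms(1) and F = assms(2) and Fm = assms(3) and a = assms(4) and b = assms(5)
  have a0: "a > 0" using False A1_norm_nonneg[OF F] a by simp
  \<comment> \<open>If the product of \<open>F\<close> with the power vanished on the half-plane,
    then so would \<open>F\<close>, because a power of a nonzero number is nonzero.\<close>
  have "b \<noteq> 0"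
  proof
    assume "b = 0"
    then have "?Fm z = 0" if "Re z > 0" for z using A1_norm_eq_0[OF Fm] b that by simp
    then have "F z = 0" if "Re z > 0" for z using that by fastforce
    then show False using A1_norm_eq_0[OF F] a False by simp
  qed
  then have b0: "b > 0" using A1_norm_nonneg[OF Fm] b by simp
  define c where "c = c_const \<beta>"
  have c: "c \<ge> 1" unfolding c_def by (rule c_const_ge_1[OF \<beta>])
  define t where "t = (a / b) powr (1 / \<beta>) * c powr (- 1 / \<beta>)"
  have t: "t > 0" using a0 b0 c by (simp add: t_def)
  have "t powr (- \<beta>) = (a / b) powr (- 1) * c powr 1"
    using a0 b0 c \<beta> by (simp add: t_def powr_mult powr_powr)
  then have bal: "b * c = a * t powr (- \<beta>)"
    using a0 b0 c by (simp add: powr_minus)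
  obtain \<alpha> \<gamma> N where S: "0 \<le> \<alpha>" "0 \<le> \<gamma>" "finite_measure N" "sets N = sets (restrict_space borel {0<..})"
    "\<And>x. 0 < x \<Longrightarrow> f x = \<alpha> * x powr (- \<beta>) + \<gamma> + (LINT s|N. (1 + s) powr \<beta> * (x + s) powr (- \<beta>))"
    by (rule gen_stieltjes_finite_measure[OF assms(6)]) blast
  have "A1_norm ?Fm * c_const \<beta> \<le> A1_norm F * t powr (- \<beta>)" using bal unfolding a b c_def by simp
  then obtain K where K: "K \<in> A1_plus"
    "A1_norm K \<le> 2 powr \<beta> * A1_norm F * (LINT s|N. (1 + s) powr \<beta> * (t + s) powr (- \<beta>))"
    "\<And>x. 0 < x \<Longrightarrow> K (complex_of_real x) =
       F (complex_of_real x) * complex_of_real (LINT s|N. (1 + s) powr \<beta> * (x + s) powr (- \<beta>))"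
    by (rule A1_plus_stieltjes_integral[OF \<beta> F Fm S(3,4) t]) blast
  let ?L = "\<lambda>z. complex_of_real \<alpha> * ?Fm z + complex_of_real \<gamma> * F z"
  let ?S = "\<lambda>z. ?L z + K z"
  note L1 = A1_plus_cmult(1)[OF Fm, of "complex_of_real \<alpha>"] and L2 = A1_plus_cmult(1)[OF F, of "complex_of_real \<gamma>"]
  have L: "?L \<in> A1_plus" by (rule A1_plus_add(1)[OF L1 L2])
  have S1: "?S \<in> A1_plus" by (rule A1_plus_add(1)[OF L K(1)])
  have "A1_norm ?S \<le> A1_norm ?L + A1_norm K" by (rule A1_plus_add(2)[OF L K(1)])
  moreover have "A1_norm ?L \<le> \<alpha> * b + \<gamma> * a"
    using A1_plus_add(2)[OF L1 L2] A1_plus_cmult(2)[OF Fm, of "complex_of_real \<alpha>"]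
      A1_plus_cmult(2)[OF F, of "complex_of_real \<gamma>"] S(1,2) a b by simp
  \<comment> \<open>The term with \<open>\<alpha>\<close> comes with the norm \<open>b\<close>
    alone, and \<open>b \<le> b * c = a * t powr (- \<beta>)\<close> brings it into the shape of the
    corresponding term of \<open>f t\<close>. For both terms outside the integral the factor
    \<open>2 powr \<beta> \<ge> 1\<close> is simply given away.\<close>
  moreover have "\<alpha> * b + \<gamma> * a \<le> 2 powr \<beta> * a * (\<alpha> * t powr (- \<beta>) + \<gamma>)"
  proof -
    have "b * 1 \<le> b * c" using b0 c by (intro mult_left_mono) auto
    then have "\<alpha> * b \<le> \<alpha> * (a * t powr (- \<beta>))" using S(1) bal by (intro mult_left_mono) auto
    then have "\<alpha> * b + \<gamma> * a \<le> 1 * (a * (\<alpha> * t powr (- \<beta>) + \<gamma>))" by (simp add: algebra_simps)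
    also have "\<dots> \<le> 2 powr \<beta> * (a * (\<alpha> * t powr (- \<beta>) + \<gamma>))"
      using \<beta> S(1,2) a0 by (intro mult_right_mono ge_one_powr_ge_zero) auto
    finally show ?thesis by (simp add: mult.assoc)
  qed
  ultimately have "A1_norm ?S \<le> 2 powr \<beta> * a * (\<alpha> * t powr (- \<beta>) + \<gamma>) +
      2 powr \<beta> * a * (LINT s|N. (1 + s) powr \<beta> * (t + s) powr (- \<beta>))"
    using K(2) unfolding a by linarith
  also have "\<dots> = 2 powr \<beta> * a * f t" by (simp only: S(5)[OF t] distrib_left)
  finally have norm: "A1_norm ?S \<le> 2 powr \<beta> * a * f t" .
  \<comment> \<open>The extension \<open>g\<close> is known only through its holomorphy and its
    values on the positive reals, so the product is identified with \<open>?S\<close> by the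
    identity theorem.\<close>
  have "F holomorphic_on {z. Re z > 0}" by (rule A1_plus_holomorphic[OF F])
  moreover have "g holomorphic_on {z. Re z > 0}"
    using assms(7) unfolding analytic_extension_def
    by (rule holomorphic_on_subset[OF conjunct1]) (auto simp: complex_nonpos_Reals_iff)
  ultimately have hol: "(\<lambda>z. F z * g z) holomorphic_on {z. Re z > 0}" by (intro holomorphic_intros)
  have eq: "F z * g z = ?S z" if "Re z > 0" for z
  proof (rule holomorphic_eq_right_half_plane[OF hol A1_plus_holomorphic[OF S1] _ that])
    fix x :: real assume x: "0 < x"
    have e1: "?Fm (complex_of_real x) = complex_of_real (x powr (- \<beta>)) * F (complex_of_real x)"
      using x powr_of_real[of x "- \<beta>"] by simp
    have e2: "g (complex_of_real x) = complex_of_real (f x)"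
      using assms(7) x by (simp add: analytic_extension_def)
    show "F (complex_of_real x) * g (complex_of_real x) = ?S (complex_of_real x)"
      unfolding e1 e2 K(3)[OF x] S(5)[OF x] by (simp add: algebra_simps)
  qed
  have "(\<lambda>z. F z * g z) \<in> A1_plus \<longleftrightarrow> ?S \<in> A1_plus" "A1_norm (\<lambda>z. F z * g z) = A1_norm ?S"
    by (rule A1_plus_cong; rule eq; assumption)+
  then show ?thesis
    using S1 norm unfolding t_def c_def by simp
qed

end
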